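(* Let $PG$ be the Petersen graph and let $f:PG\to\mathbb{R}^{2}$ be a plane generic immersion. Let $D_1(PG)$ be the set of all unordered pairs $(d,e)$ of edges of $PG$ whose distance in $PG$ is $1$. Then \[ \sum_{(d,e)\in D_{1}(PG)}|f(d)\cap f(e)|\equiv 1\pmod 2. \]
   Context: A finite graph $G$ is regarded as a topological space in the usual way. A plane generic immersion of $G$ is an immersion $f:G\to\mathbb{R}^2$ (a continuous locally injective, piecewise smooth map) whose multiple points are only finitely many transversal double points between edges, i.e. between interior points of edges (possibly of the same edge). The distance of two connected subgraphs (in particular two edges) of $G$ is the minimum number of edges of a path of $G$ joining them; so two distinct edges have distance $0$ iff they are adjacent, and distance $1$ iff they are disjoint and some edge of $G$ is adjacent to both. The Petersen graph $PG$ has vertices $u_i,v_i$ ($i\in\mathbb{Z}/5\mathbb{Z}$) and the $15$ edges $u_iu_{i+1}$, $u_iv_i$, $v_iv_{i+2}$. $|X|$ denotes the number of elements of a finite set $X$. *)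

theory Defs
  imports "HOL-Analysis.Analysis" "HOL-Library.Extended_Nat" "HOL-Number_Theory.Cong"
begin

text \<open>
  A finite simple graph is given by its set \<open>E\<close> of edges, each a two-element set of vertices; the
  vertex set is the whole (finite) type \<open>'v\<close>.  Its underlying topological space is the standard
  geometric realization in \<open>real^'v\<close>, with vertices at the standard basis vectors.
\<close>

definition vertex_point :: "'v::finite \<Rightarrow> real^'v" where
  "vertex_point v = axis v 1"

definition edge_arc :: "'v::finite set \<Rightarrow> (real^'v) set" where
  "edge_arc e = convex hull (vertex_point ` e)"

definition realization :: "'v::finite set set \<Rightarrow> (real^'v) set" where
  "realization E = range vertex_point \<union> (\<Union>e\<in>E. edge_arc e)"

text \<open>A path is a nonempty list of distinct, successively adjacent vertices; the path \<open>xs\<close> has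
  \<open>length xs - 1\<close> edges.\<close>

definition graph_path :: "'v set set \<Rightarrow> 'v list \<Rightarrow> bool" where
  "graph_path E xs \<longleftrightarrow> xs \<noteq> [] \<and> distinct xs \<and> successively (\<lambda>x y. {x, y} \<in> E) xs"

text \<open>The distance of two connected subgraphs, given by their vertex sets.  An edge is its own
  vertex set.  The distance is infinite if no path joins them.\<close>

definition graph_distance :: "'v set set \<Rightarrow> 'v set \<Rightarrow> 'v set \<Rightarrow> enat" where
  "graph_distance E A B =
     (INF xs \<in> {xs. graph_path E xs \<and> hd xs \<in> A \<and> last xs \<in> B}. enat (length xs - 1))"

text \<open>An unordered pair of edges at distance 1 consists of two different edges, so it is
  represented by the set \<open>{d, e}\<close>.\<close>

definition edge_pairs_at_distance_1 :: "'v set set \<Rightarrow> 'v set set set" where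
  "edge_pairs_at_distance_1 E = {{d, e} | d e. d \<in> E \<and> e \<in> E \<and> graph_distance E d e = 1}"

text \<open>``Piecewise smooth'' is the library's piecewise continuous differentiability of the
  restriction to each edge.  Only the values of \<open>f\<close> on the realization matter.\<close>

definition graph_immersion :: "'v::finite set set \<Rightarrow> (real^'v \<Rightarrow> real^2) \<Rightarrow> bool" where
  "graph_immersion E f \<longleftrightarrow>
     continuous_on (realization E) f \<and>
     (\<forall>x\<in>realization E. \<exists>U. open U \<and> x \<in> U \<and> inj_on f (U \<inter> realization E)) \<and>
     (\<forall>a b. {a, b} \<in> E \<longrightarrow>
        (f \<circ> linepath (vertex_point a) (vertex_point b)) piecewise_C1_differentiable_on {0..1})"

definition edge_tangent ::
  "'v::finite set set \<Rightarrow> (real^'v \<Rightarrow> real^2) \<Rightarrow> real^'v \<Rightarrow> real^2 \<Rightarrow> bool" where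
  "edge_tangent E f x T \<longleftrightarrow>
     (\<exists>a b t. {a, b} \<in> E \<and> 0 < t \<and> t < 1 \<and> x = linepath (vertex_point a) (vertex_point b) t \<and>
        ((f \<circ> linepath (vertex_point a) (vertex_point b)) has_vector_derivative T) (at t))"

text \<open>Points at which \<open>edge_tangent\<close> holds are interior points of edges, so both preimages of a
  transversal double point are.  Linear independence does not depend on how the edges are
  oriented.  The condition \<open>S \<noteq> T\<close> is needed because \<open>independent\<close> speaks about the set
  \<open>{S, T}\<close>.\<close>

definition transversal_double_point ::
  "'v::finite set set \<Rightarrow> (real^'v \<Rightarrow> real^2) \<Rightarrow> real^2 \<Rightarrow> bool" where
  "transversal_double_point E f p \<longleftrightarrow>
     (\<exists>x y S T. x \<noteq> y \<and> {z \<in> realization E. f z = p} = {x, y} \<and>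
        edge_tangent E f x S \<and> edge_tangent E f y T \<and> S \<noteq> T \<and> independent {S, T})"

definition multiple_points :: "'v::finite set set \<Rightarrow> (real^'v \<Rightarrow> real^2) \<Rightarrow> (real^2) set" where
  "multiple_points E f =
     {p. \<exists>x\<in>realization E. \<exists>y\<in>realization E. x \<noteq> y \<and> f x = p \<and> f y = p}"

definition plane_generic_immersion :: "'v::finite set set \<Rightarrow> (real^'v \<Rightarrow> real^2) \<Rightarrow> bool" where
  "plane_generic_immersion E f \<longleftrightarrow>
     graph_immersion E f \<and> finite (multiple_points E f) \<and>
     (\<forall>p\<in>multiple_points E f. transversal_double_point E f p)"

text \<open>The numeral type \<open>5\<close> is the ring of integers modulo 5.\<close>

datatype petersen_vertex = U 5 | V 5

instance petersen_vertex :: finite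
proof
  have "(UNIV :: petersen_vertex set) = range U \<union> range V"
    by (auto intro: petersen_vertex.exhaust)
  then show "finite (UNIV :: petersen_vertex set)"
    by (metis finite_UnI finite finite_imageI)
qed

definition petersen_edges :: "petersen_vertex set set" where
  "petersen_edges =
     range (\<lambda>i. {U i, U (i + 1)}) \<union> range (\<lambda>i. {U i, V i}) \<union> range (\<lambda>i. {V i, V (i + 2)})"

end

theory Submission
  imports Defs "HOL-Complex_Analysis.Winding_Numbers"
begin

text \<open>
  For disjoint edges parametrized by \<open>\<alpha>\<close> and \<open>\<beta>\<close>, the number of crossings has the parity of the
  winding number of \<open>(s, t) \<mapsto> \<alpha> s - \<beta> t\<close> around \<open>0\<close> on the boundary of the unit square, since every
  transversal zero contributes an odd number.  This winding number is the sum of four terms, each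
  describing how one edge turns around an end of the other edge.  Every such term equals a difference
  of arguments of vertex directions plus an integer depending only on a vertex and a disjoint edge.
  In the sum over all pairs at distance 1 every such integer occurs twice, and the arguments
  leave the number of crossing pairs in a convex drawing with the same vertex order, which is 21.
\<close>

section \<open>The degree of a plane-valued map on the boundary of a rectangle\<close>

text \<open>A common route deforms the immersion into a fixed drawing by local moves and follows the
  effect of each move. Here nothing is deformed: what an edge passing over a vertex would change is
  recorded by the integer attached to that vertex and that edge, and only the number of its
  occurrences matters, not its value.

  The integer of a vertex \<open>v\<close> and an edge \<open>e\<close> occurs once for each edge at
  \<open>v\<close> that has distance 1 from \<open>e\<close>. The Petersen graph is cubic with girth
  5, so the four neighbours of \<open>e\<close> are distinct and pairwise nonadjacent, and each has
  two edges besides the one to \<open>e\<close>. Each of the four remaining vertices has exactly one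
  common neighbour with either end of \<open>e\<close>. Hence there are none of these edges at an
  end of \<open>e\<close> and two at every other vertex.

  Working modulo 2 also makes the signs of the crossings irrelevant: a transversal crossing only has
  to contribute an odd number.\<close>

text \<open>The path need not be closed, so the value need not be an integer, nor even real.\<close>

definition turning :: "(real \<Rightarrow> complex) \<Rightarrow> real \<Rightarrow> real \<Rightarrow> complex" where
  "turning g u v = winding_number (g \<circ> linepath u v) 0"

text \<open>The working form of \<open>turning\<close>: a continuous logarithm replaces the path,
  and only its end values enter.\<close>

lemma turning_eq_log_diff:
  assumes "u \<le> v" "continuous_on {u..v} q" "\<And>x. x \<in> {u..v} \<Longrightarrow> g x = exp (q x)"
  shows "turning g u v = (q v - q u) / (2 * of_real pi * \<i>)"
proof -
  have seg: "linepath u v t \<in> {u..v}" if "0 \<le> t" "t \<le> 1" for t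
    using linepath_in_path[of t u v] that assms(1) by (auto simp: closed_segment_eq_real_ivl)
  have "path (q \<circ> linepath u v)"
    unfolding path_def
    by (rule continuous_on_compose[OF continuous_on_linepath])
       (rule continuous_on_subset[OF assms(2)], use seg in auto)
  then have "winding_number (exp \<circ> (q \<circ> linepath u v)) 0 = (q v - q u) / (2 * of_real pi * \<i>)"
    by (subst winding_number_compose_exp) (auto simp: pathstart_def pathfinish_def linepath_def)
  moreover have "turning g u v = winding_number (exp \<circ> (q \<circ> linepath u v)) 0"
    unfolding turning_def by (rule winding_number_cong) (use assms(3) seg in auto)
  ultimately show ?thesis by simp
qed

lemma continuous_log_on_convex:
  fixes g :: "'a::real_normed_vector \<Rightarrow> complex"
  assumes "convex S" "continuous_on S g" "\<And>x. x \<in> S \<Longrightarrow> g x \<noteq> 0"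
  obtains q where "continuous_on S q" "\<And>x. x \<in> S \<Longrightarrow> g x = exp (q x)"
  using continuous_logarithm_on_contractible[OF assms(2) convex_imp_contractible[OF assms(1)] assms(3)]
  by blast

lemma turning_split:
  assumes "u \<le> v" "v \<le> w" "continuous_on {u..w} g" "\<And>x. x \<in> {u..w} \<Longrightarrow> g x \<noteq> 0"
  shows "turning g u w = turning g u v + turning g v w"
proof -
  obtain q where q: "continuous_on {u..w} q" "\<And>x. x \<in> {u..w} \<Longrightarrow> g x = exp (q x)"
    using continuous_log_on_convex[OF _ assms(3,4)] convex_real_interval by blast
  have "turning g u w = (q w - q u) / (2 * of_real pi * \<i>)"
    using assms q by (intro turning_eq_log_diff) auto
  moreover have "turning g u v = (q v - q u) / (2 * of_real pi * \<i>)"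
    using assms q by (intro turning_eq_log_diff continuous_on_subset[OF q(1)]) auto
  moreover have "turning g v w = (q w - q v) / (2 * of_real pi * \<i>)"
    using assms q by (intro turning_eq_log_diff continuous_on_subset[OF q(1)]) auto
  ultimately show ?thesis by (simp flip: add_divide_distrib)
qed

text \<open>The ends of a curve determine its turning up to an integer. Comparing this exponential
  with another logarithm of the same quotient is how integers enter: once for a linear map on a
  square, once for an edge seen from a vertex.\<close>

lemma exp_turning:
  assumes "u \<le> v" "continuous_on {u..v} g" "\<And>x. x \<in> {u..v} \<Longrightarrow> g x \<noteq> 0"
  shows "exp (2 * of_real pi * \<i> * turning g u v) = g v / g u"
proof -
  obtain q where q: "continuous_on {u..v} q" "\<And>x. x \<in> {u..v} \<Longrightarrow> g x = exp (q x)"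
    using continuous_log_on_convex[OF _ assms(2,3)] convex_real_interval by blast
  have "turning g u v = (q v - q u) / (2 * of_real pi * \<i>)"
    using assms q by (intro turning_eq_log_diff) auto
  then show ?thesis using q(2)[of u] q(2)[of v] assms(1) by (simp add: exp_diff)
qed

lemma turning_uminus:
  assumes "u \<le> v" "continuous_on {u..v} g" "\<And>x. x \<in> {u..v} \<Longrightarrow> g x \<noteq> 0"
  shows "turning (\<lambda>x. - g x) u v = turning g u v"
proof -
  obtain q where q: "continuous_on {u..v} q" "\<And>x. x \<in> {u..v} \<Longrightarrow> g x = exp (q x)"
    using continuous_log_on_convex[OF _ assms(2,3)] convex_real_interval by blast
  have "turning g u v = (q v - q u) / (2 * of_real pi * \<i>)"
    using assms q by (intro turning_eq_log_diff) auto
  moreover have "turning (\<lambda>x. - g x) u v = ((q v + \<i> * pi) - (q u + \<i> * pi)) / (2 * of_real pi * \<i>)"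
    using assms q by (intro turning_eq_log_diff continuous_intros) (auto simp: exp_add exp_pi_i')
  ultimately show ?thesis by simp
qed

lemma turning_reflect:
  assumes "0 \<le> r" "continuous_on {-r..r} g" "\<And>x. x \<in> {-r..r} \<Longrightarrow> g x \<noteq> 0"
  shows "turning (\<lambda>x. g (- x)) (-r) r = - turning g (-r) r"
proof -
  obtain q where q: "continuous_on {-r..r} q" "\<And>x. x \<in> {-r..r} \<Longrightarrow> g x = exp (q x)"
    using continuous_log_on_convex[OF _ assms(2,3)] convex_real_interval by blast
  have "turning g (-r) r = (q r - q (-r)) / (2 * of_real pi * \<i>)"
    using assms q by (intro turning_eq_log_diff) auto
  moreover have "continuous_on {-r..r} (\<lambda>x. q (- x))"
    by (rule continuous_on_compose2[OF q(1)]) (auto intro: continuous_intros)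
  then have "turning (\<lambda>x. g (- x)) (-r) r = (q (-r) - q (-(-r))) / (2 * of_real pi * \<i>)"
    using assms q by (intro turning_eq_log_diff) auto
  ultimately show ?thesis by (simp add: minus_divide_left)
qed

text \<open>The quotient \<open>g x / h x\<close> stays in the disc of radius 1 about 1, hence in
  the right half-plane, where \<open>Ln\<close> is continuous. Adding its logarithm to one of
  \<open>h\<close> gives one of \<open>g\<close>. The correction involves the ends only, so it
  cancels around a closed boundary.\<close>

lemma turning_perturb:
  assumes "u \<le> v" "continuous_on {u..v} g" "continuous_on {u..v} h"
    and near: "\<And>x. x \<in> {u..v} \<Longrightarrow> norm (g x - h x) < norm (h x)"
  shows "turning g u v = turning h u v + (Ln (g v / h v) - Ln (g u / h u)) / (2 * of_real pi * \<i>)"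
proof -
  have h0: "h x \<noteq> 0" if "x \<in> {u..v}" for x using near[OF that] by auto
  obtain q where q: "continuous_on {u..v} q" "\<And>x. x \<in> {u..v} \<Longrightarrow> h x = exp (q x)"
    using continuous_log_on_convex[OF _ assms(3) h0] convex_real_interval by blast
  have re: "Re (g x / h x) > 0" if "x \<in> {u..v}" for x
  proof -
    have "norm (g x / h x - 1) < 1"
      using near[OF that] h0[OF that] norm_divide[of "g x - h x" "h x"]
      by (simp add: diff_divide_distrib)
    moreover have "\<bar>Re (g x / h x - 1)\<bar> \<le> norm (g x / h x - 1)" by (rule abs_Re_le_cmod)
    ultimately show ?thesis by simp
  qed
  have "continuous_on {u..v} (\<lambda>x. q x + Ln (g x / h x))"
    using h0 re assms q by (intro continuous_intros) (auto simp: complex_nonpos_Reals_iff not_le)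
  moreover have "g x = exp (q x + Ln (g x / h x))" if "x \<in> {u..v}" for x
    using h0[OF that] re[OF that] q(2)[OF that] by (subst exp_add, subst exp_Ln) auto
  ultimately have "turning g u v = ((q v + Ln (g v / h v)) - (q u + Ln (g u / h u))) / (2 * of_real pi * \<i>)"
    using assms(1) by (intro turning_eq_log_diff) auto
  moreover have "turning h u v = (q v - q u) / (2 * of_real pi * \<i>)"
    using assms q by (intro turning_eq_log_diff) auto
  ultimately show ?thesis by (simp add: add_divide_distrib diff_divide_distrib)
qed

section \<open>Degree around a rectangle: cutting, zero-free maps, perturbation\<close>

lemma continuous_on_sections:
  assumes "continuous_on (A \<times> B) (\<lambda>(s, t). G s t)"
  shows "y \<in> B \<Longrightarrow> continuous_on A (\<lambda>s. G s y)" and "x \<in> A \<Longrightarrow> continuous_on B (G x)"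
proof -
  show "continuous_on A (\<lambda>s. G s y)" if "y \<in> B"
    using continuous_on_compose2[OF assms, of A "\<lambda>s. (s, y)"] that
    by (simp add: continuous_on_Pair image_subset_iff)
  show "continuous_on B (G x)" if "x \<in> A"
    using continuous_on_compose2[OF assms, of B "\<lambda>t. (x, t)"] that
    by (simp add: continuous_on_Pair image_subset_iff)
qed

text \<open>One counterclockwise circuit: the bottom and right sides count positively, the top and
  left sides negatively. Keeping the sides separate lets common sides cancel and lets each side
  later be read as one edge seen from one vertex.\<close>

definition rect_degree :: "(real \<Rightarrow> real \<Rightarrow> complex) \<Rightarrow> real \<Rightarrow> real \<Rightarrow> real \<Rightarrow> real \<Rightarrow> complex" where
  "rect_degree G a b c d =
     turning (\<lambda>s. G s c) a b + turning (\<lambda>t. G b t) c d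
     - turning (\<lambda>s. G s d) a b - turning (\<lambda>t. G a t) c d"

text \<open>The inner side occurs in both summands with opposite signs, so nonvanishing is required
  on the two sides that are cut.\<close>

lemma rect_degree_split_fst:
  assumes "a \<le> m" "m \<le> b"
    "continuous_on {a..b} (\<lambda>s. G s c)" "continuous_on {a..b} (\<lambda>s. G s d)"
    "\<And>s. s \<in> {a..b} \<Longrightarrow> G s c \<noteq> 0 \<and> G s d \<noteq> 0"
  shows "rect_degree G a b c d = rect_degree G a m c d + rect_degree G m b c d"
  using turning_split[of a m b "\<lambda>s. G s c"] turning_split[of a m b "\<lambda>s. G s d"] assms
  unfolding rect_degree_def by simp

lemma rect_degree_split_snd:
  assumes "c \<le> m" "m \<le> d"
    "continuous_on {c..d} (G a)" "continuous_on {c..d} (G b)"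
    "\<And>t. t \<in> {c..d} \<Longrightarrow> G a t \<noteq> 0 \<and> G b t \<noteq> 0"
  shows "rect_degree G a b c d = rect_degree G a b c m + rect_degree G a b m d"
  using turning_split[of c m d "G a"] turning_split[of c m d "G b"] assms
  unfolding rect_degree_def by simp

text \<open>A single logarithm on the whole rectangle serves all four sides, and its values at the
  corners cancel.\<close>

lemma rect_degree_zero_free:
  assumes "a \<le> b" "c \<le> d" and cont: "continuous_on ({a..b} \<times> {c..d}) (\<lambda>(s, t). G s t)"
    and nz: "\<And>s t. s \<in> {a..b} \<Longrightarrow> t \<in> {c..d} \<Longrightarrow> G s t \<noteq> 0"
  shows "rect_degree G a b c d = 0"
proof -
  have "convex ({a..b} \<times> {c..d})"
    by (intro convex_Times convex_real_interval)
  moreover have "(\<lambda>(s, t). G s t) x \<noteq> 0" if "x \<in> {a..b} \<times> {c..d}" for x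
    using nz that by auto
  ultimately obtain q where q: "continuous_on ({a..b} \<times> {c..d}) q"
      "\<And>x. x \<in> {a..b} \<times> {c..d} \<Longrightarrow> (\<lambda>(s, t). G s t) x = exp (q x)"
    using continuous_log_on_convex[OF _ cont] by blast
  have h: "turning (\<lambda>s. G s y) a b = (q (b, y) - q (a, y)) / (2 * of_real pi * \<i>)" if "y \<in> {c..d}" for y
  proof (rule turning_eq_log_diff[where q = "\<lambda>s. q (s, y)"])
    show "continuous_on {a..b} (\<lambda>s. q (s, y))"
      by (rule continuous_on_compose2[OF q(1)]) (use that in \<open>auto intro!: continuous_on_Pair continuous_on_id continuous_on_const\<close>)
  qed (use q(2) assms(1) that in auto)
  have v: "turning (\<lambda>t. G x t) c d = (q (x, d) - q (x, c)) / (2 * of_real pi * \<i>)" if "x \<in> {a..b}" for x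
  proof (rule turning_eq_log_diff[where q = "\<lambda>t. q (x, t)"])
    show "continuous_on {c..d} (\<lambda>t. q (x, t))"
      by (rule continuous_on_compose2[OF q(1)]) (use that in \<open>auto intro!: continuous_on_Pair continuous_on_id continuous_on_const\<close>)
  qed (use q(2) assms(2) that in auto)
  show ?thesis unfolding rect_degree_def using assms(1,2) by (simp add: h v diff_divide_distrib)
qed

text \<open>Rouche's principle: each of the four corners receives its logarithmic correction once
  with either sign.\<close>

lemma rect_degree_perturb:
  assumes "a \<le> b" "c \<le> d"
    and contG: "continuous_on ({a..b} \<times> {c..d}) (\<lambda>(s, t). G s t)"
    and contH: "continuous_on ({a..b} \<times> {c..d}) (\<lambda>(s, t). H s t)"
    and near: "\<And>s t. s \<in> {a..b} \<Longrightarrow> t \<in> {c..d} \<Longrightarrow> s \<in> {a, b} \<or> t \<in> {c, d}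
                 \<Longrightarrow> norm (G s t - H s t) < norm (H s t)"
  shows "rect_degree G a b c d = rect_degree H a b c d"
proof -
  have h: "turning (\<lambda>s. G s y) a b = turning (\<lambda>s. H s y) a b
      + (Ln (G b y / H b y) - Ln (G a y / H a y)) / (2 * of_real pi * \<i>)" if "y \<in> {c, d}" for y
  proof (intro turning_perturb)
    show "continuous_on {a..b} (\<lambda>s. G s y)" "continuous_on {a..b} (\<lambda>s. H s y)"
      using that \<open>c \<le> d\<close> continuous_on_sections(1)[OF contG] continuous_on_sections(1)[OF contH] by auto
  qed (use assms(1,2) near that in auto)
  have v: "turning (\<lambda>t. G x t) c d = turning (\<lambda>t. H x t) c d
      + (Ln (G x d / H x d) - Ln (G x c / H x c)) / (2 * of_real pi * \<i>)" if "x \<in> {a, b}" for x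
  proof (intro turning_perturb)
    show "continuous_on {c..d} (G x)" "continuous_on {c..d} (H x)"
      using that \<open>a \<le> b\<close> continuous_on_sections(2)[OF contG] continuous_on_sections(2)[OF contH] by auto
  qed (use assms(1,2) near that in auto)
  show ?thesis unfolding rect_degree_def by (simp add: h v diff_divide_distrib)
qed

text \<open>By central symmetry opposite sides contribute equally, and half of the boundary turns the value
  at a corner into its negative, so it contributes a half-integer.\<close>

lemma rect_degree_linear_odd:
  fixes A B :: complex
  assumes "0 < r" and ind: "\<And>x y::real. x *\<^sub>R A - y *\<^sub>R B = 0 \<Longrightarrow> x = 0 \<and> y = 0"
  shows "\<exists>k::int. rect_degree (\<lambda>s t. s *\<^sub>R A - t *\<^sub>R B) (-r) r (-r) r = of_int (2 * k + 1)"
proof -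
  \<comment> \<open>\<open>p\<close> and \<open>q\<close> run along the bottom and the right side.
    On each of them one coefficient is \<open>r\<close> or \<open>-r\<close>, so independence
    excludes zeros there.\<close>
  define p where "p s = s *\<^sub>R A - (-r) *\<^sub>R B" for s :: real
  define q where "q t = r *\<^sub>R A - t *\<^sub>R B" for t :: real
  have cont: "continuous_on X p" "continuous_on X q" for X
    unfolding p_def q_def by (intro continuous_intros)+
  have nz: "p x \<noteq> 0" "q x \<noteq> 0" for x
    using ind[of x "-r"] ind[of r x] \<open>0 < r\<close> unfolding p_def q_def by auto
  have "turning (\<lambda>s. s *\<^sub>R A - r *\<^sub>R B) (-r) r = turning (\<lambda>s. - p (- s)) (-r) r"
    by (simp add: p_def)
  also have "\<dots> = turning (\<lambda>s. p (- s)) (-r) r"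
    using \<open>0 < r\<close> nz by (intro turning_uminus continuous_on_compose2[OF cont(1)] continuous_intros) auto
  also have "\<dots> = - turning p (-r) r"
    using \<open>0 < r\<close> nz cont by (intro turning_reflect) auto
  finally have 1: "turning (\<lambda>s. s *\<^sub>R A - r *\<^sub>R B) (-r) r = - turning p (-r) r" .
  have "turning (\<lambda>t. (-r) *\<^sub>R A - t *\<^sub>R B) (-r) r = turning (\<lambda>t. - q (- t)) (-r) r"
    by (simp add: q_def)
  also have "\<dots> = turning (\<lambda>t. q (- t)) (-r) r"
    using \<open>0 < r\<close> nz by (intro turning_uminus continuous_on_compose2[OF cont(2)] continuous_intros) auto
  also have "\<dots> = - turning q (-r) r"
    using \<open>0 < r\<close> nz cont by (intro turning_reflect) auto
  finally have 2: "turning (\<lambda>t. (-r) *\<^sub>R A - t *\<^sub>R B) (-r) r = - turning q (-r) r" .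
  have deg: "rect_degree (\<lambda>s t. s *\<^sub>R A - t *\<^sub>R B) (-r) r (-r) r = 2 * (turning p (-r) r + turning q (-r) r)"
    unfolding rect_degree_def 1 2 p_def[abs_def, symmetric] q_def[abs_def, symmetric] by simp
  have "exp (2 * of_real pi * \<i> * (turning p (-r) r + turning q (-r) r))
      = (p r / p (-r)) * (q r / q (-r))"
    using exp_turning[of "-r" r p] exp_turning[of "-r" r q] cont nz \<open>0 < r\<close>
    by (simp add: ring_distribs exp_add)
  also have "\<dots> = -1"
  proof -
    \<comment> \<open>The right side starts at the corner where the bottom side ends, and it ends at
      the corner opposite to the start of the bottom side.\<close>
    have e: "q (-r) = p r" "q r = - p (- r)" by (simp_all add: p_def q_def)
    show ?thesis unfolding e using nz(1) by simp
  qed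
  finally have "exp (2 * of_real pi * \<i> * (turning p (-r) r + turning q (-r) r)) = exp (\<i> * pi)"
    by (simp add: exp_pi_i')
  then obtain n :: int where
    "2 * of_real pi * \<i> * (turning p (-r) r + turning q (-r) r) = \<i> * pi + (of_int (2 * n) * pi) * \<i>"
    unfolding exp_eq by auto
  then have "(2 * (turning p (-r) r + turning q (-r) r)) * (\<i> * pi) = of_int (2 * n + 1) * (\<i> * pi)"
    by (simp add: algebra_simps)
  then have "2 * (turning p (-r) r + turning q (-r) r) = of_int (2 * n + 1)"
    using mult_cancel_right[of _ "\<i> * of_real pi"] by (simp add: pi_neq_zero)
  then show ?thesis unfolding deg by blast
qed

section \<open>Transversal crossings and the parity of the number of zeros\<close>

lemma turning_shift: "turning (\<lambda>x. g (x + k)) u v = turning g (u + k) (v + k)"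
proof -
  have "(\<lambda>x. g (x + k)) \<circ> linepath u v = g \<circ> linepath (u + k) (v + k)"
    by (auto simp: linepath_def algebra_simps)
  then show ?thesis by (simp only: turning_def)
qed

lemma rect_degree_shift:
  "rect_degree (\<lambda>s t. G (s + k) (t + l)) a b c d = rect_degree G (a + k) (b + k) (c + l) (d + l)"
  unfolding rect_degree_def
  by (simp add: turning_shift[of "\<lambda>s. G s y" for y] turning_shift[of "\<lambda>t. G x t" for x])

text \<open>The last clause is injectivity of the derivative of
  \<open>(s, t) \<mapsto> \<alpha> s - \<beta> t\<close>, the form in which independence of the
  tangents bounds that derivative from below.\<close>

definition transversal_at :: "(real \<Rightarrow> complex) \<Rightarrow> (real \<Rightarrow> complex) \<Rightarrow> real \<Rightarrow> real \<Rightarrow> bool" where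
  "transversal_at \<alpha> \<beta> s t \<longleftrightarrow> (\<exists>A B.
     (\<alpha> has_vector_derivative A) (at s) \<and> (\<beta> has_vector_derivative B) (at t) \<and>
     (\<forall>x y::real. x *\<^sub>R A - y *\<^sub>R B = 0 \<longrightarrow> x = 0 \<and> y = 0))"

lemma has_vector_derivative_remainder:
  assumes "(\<alpha> has_vector_derivative A) (at s0)" "0 < e"
  obtains \<delta> where "0 < \<delta>" "\<And>h. \<bar>h\<bar> < \<delta> \<Longrightarrow> norm (\<alpha> (h + s0) - \<alpha> s0 - h *\<^sub>R A) \<le> e * \<bar>h\<bar>"
proof -
  have "\<forall>e>0. \<exists>\<delta>>0. \<forall>y. norm (y - s0) < \<delta> \<longrightarrow> norm (\<alpha> y - \<alpha> s0 - (y - s0) *\<^sub>R A) \<le> e * norm (y - s0)"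
    using assms(1) unfolding has_vector_derivative_def has_derivative_at_alt by auto
  then obtain \<delta> where d: "0 < \<delta>" "\<And>y. norm (y - s0) < \<delta> \<Longrightarrow> norm (\<alpha> y - \<alpha> s0 - (y - s0) *\<^sub>R A) \<le> e * norm (y - s0)"
    using assms(2) by blast
  show ?thesis
  proof (rule that[OF d(1)])
    fix h :: real assume "\<bar>h\<bar> < \<delta>"
    then show "norm (\<alpha> (h + s0) - \<alpha> s0 - h *\<^sub>R A) \<le> e * \<bar>h\<bar>" using d(2)[of "h + s0"] by simp
  qed
qed

text \<open>On the boundary of a small square around the crossing the linear part dominates the
  remainder, so the degree is that of the linear part, which is odd.\<close>

lemma rect_degree_local_odd:
  assumes ab: "a < s0" "s0 < b" and cd: "c < t0" "t0 < d"
    and cont: "continuous_on {a..b} \<alpha>" "continuous_on {c..d} \<beta>"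
    and zero: "\<alpha> s0 = \<beta> t0" and "transversal_at \<alpha> \<beta> s0 t0"
  obtains r k where "0 < r" "a < s0 - r" "s0 + r < b" "c < t0 - r" "t0 + r < d"
    "rect_degree (\<lambda>s t. \<alpha> s - \<beta> t) (s0 - r) (s0 + r) (t0 - r) (t0 + r) = of_int k" "odd (k::int)"
proof -
  obtain A B where der: "(\<alpha> has_vector_derivative A) (at s0)" "(\<beta> has_vector_derivative B) (at t0)"
    and ind: "\<And>x y::real. x *\<^sub>R A - y *\<^sub>R B = 0 \<Longrightarrow> x = 0 \<and> y = 0"
    using assms unfolding transversal_at_def by blast
  define L where "L = (\<lambda>(x::real, y::real). x *\<^sub>R A - y *\<^sub>R B)"
  have lin: "linear L"
    by (rule linearI) (auto simp: L_def algebra_simps)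
  have "inj L"
    unfolding linear_injective_0[OF lin] using ind by (auto simp: L_def zero_prod_def)
  then obtain m where m: "m > 0" "\<And>z. m * norm z \<le> norm (L z)"
    using linear_inj_bounded_below_pos[OF lin] by metis
  obtain \<delta>1 where d1: "0 < \<delta>1" "\<And>h. \<bar>h\<bar> < \<delta>1 \<Longrightarrow> norm (\<alpha> (h + s0) - \<alpha> s0 - h *\<^sub>R A) \<le> m / 3 * \<bar>h\<bar>"
    \<comment> \<open>On the boundary of the square the linear part has norm at least
      \<open>m * r\<close>. Two errors of at most \<open>m / 3 * r\<close>, one for each curve, stay
      strictly below it.\<close>
    using has_vector_derivative_remainder[OF der(1), of "m / 3"] m(1) by auto
  obtain \<delta>2 where d2: "0 < \<delta>2" "\<And>h. \<bar>h\<bar> < \<delta>2 \<Longrightarrow> norm (\<beta> (h + t0) - \<beta> t0 - h *\<^sub>R B) \<le> m / 3 * \<bar>h\<bar>"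
    using has_vector_derivative_remainder[OF der(2), of "m / 3"] m(1) by auto
  define S where "S = {\<delta>1, \<delta>2, s0 - a, b - s0, t0 - c, d - t0}"
  \<comment> \<open>Halving makes \<open>r\<close> strictly smaller than every bound, so the closed
    square lies inside the open rectangle.\<close>
  define r where "r = Min S / 2"
  have "finite S" "S \<noteq> {}" "\<forall>x\<in>S. 0 < x"
    using d1(1) d2(1) ab cd by (auto simp: S_def)
  then have "0 < Min S" "\<forall>x\<in>S. Min S \<le> x" by auto
  then have "0 < r" "\<forall>x\<in>S. r < x" unfolding r_def by fastforce+
  then have r: "0 < r" "r < \<delta>1" "r < \<delta>2" "a < s0 - r" "s0 + r < b" "c < t0 - r" "t0 + r < d"
    unfolding S_def by auto
  have "rect_degree (\<lambda>s t. \<alpha> (s + s0) - \<beta> (t + t0)) (-r) r (-r) r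
      = rect_degree (\<lambda>s t. s *\<^sub>R A - t *\<^sub>R B) (-r) r (-r) r"
  proof (rule rect_degree_perturb)
    show "continuous_on ({-r..r} \<times> {-r..r}) (\<lambda>(s, t). \<alpha> (s + s0) - \<beta> (t + t0))"
      unfolding case_prod_unfold
      by (intro continuous_on_diff continuous_on_compose2[OF cont(1)] continuous_on_compose2[OF cont(2)]
            continuous_on_add continuous_on_fst continuous_on_snd continuous_on_id continuous_on_const)
         (use r in auto)
    show "continuous_on ({-r..r} \<times> {-r..r}) (\<lambda>(s, t). s *\<^sub>R A - t *\<^sub>R B)"
      unfolding case_prod_unfold
      by (intro continuous_on_diff continuous_on_scaleR continuous_on_fst continuous_on_snd
            continuous_on_id continuous_on_const)
    fix s t assume st: "s \<in> {-r..r}" "t \<in> {-r..r}" "s \<in> {-r, r} \<or> t \<in> {-r, r}"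
    have "\<alpha> (s + s0) - \<beta> (t + t0) - (s *\<^sub>R A - t *\<^sub>R B)
        = (\<alpha> (s + s0) - \<alpha> s0 - s *\<^sub>R A) - (\<beta> (t + t0) - \<beta> t0 - t *\<^sub>R B)"
      using zero by simp
    then have "norm (\<alpha> (s + s0) - \<beta> (t + t0) - (s *\<^sub>R A - t *\<^sub>R B))
        \<le> norm (\<alpha> (s + s0) - \<alpha> s0 - s *\<^sub>R A) + norm (\<beta> (t + t0) - \<beta> t0 - t *\<^sub>R B)"
      by (simp only: norm_triangle_ineq4)
    also have "\<dots> \<le> m / 3 * \<bar>s\<bar> + m / 3 * \<bar>t\<bar>"
      using st r by (intro add_mono d1(2) d2(2)) auto
    also have "\<dots> \<le> m / 3 * r + m / 3 * r"
      using st m(1) by (intro add_mono mult_left_mono) auto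
    also have "\<dots> < m * r" using m(1) r(1) by simp
    also have "r = max \<bar>s\<bar> \<bar>t\<bar>" using st r(1) by auto
    also have "m * max \<bar>s\<bar> \<bar>t\<bar> \<le> m * norm (s, t)"
      using m(1) norm_fst_le[of s t] norm_snd_le[of t s] by (intro mult_left_mono) auto
    also have "\<dots> \<le> norm (s *\<^sub>R A - t *\<^sub>R B)"
      using m(2)[of "(s, t)"] by (simp add: L_def)
    finally show "norm (\<alpha> (s + s0) - \<beta> (t + t0) - (s *\<^sub>R A - t *\<^sub>R B)) < norm (s *\<^sub>R A - t *\<^sub>R B)" .
  qed (use r in auto)
  moreover obtain k :: int where
    "rect_degree (\<lambda>s t. s *\<^sub>R A - t *\<^sub>R B) (-r) r (-r) r = of_int (2 * k + 1)"
    using rect_degree_linear_odd[OF r(1) ind] by blast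
  ultimately have "rect_degree (\<lambda>s t. \<alpha> s - \<beta> t) (s0 - r) (s0 + r) (t0 - r) (t0 + r) = of_int (2 * k + 1)"
    using rect_degree_shift[of "\<lambda>s t. \<alpha> s - \<beta> t" s0 t0 "-r" r "-r" r] by (simp add: add.commute)
  then show ?thesis using r by (intro that[of r "2 * k + 1"]) auto
qed

text \<open>Remove the full-height strips to the left and right of a small square around the
  crossing, then the pieces below and above the square. All removed pieces are free of
  zeros.\<close>

lemma rect_degree_single_crossing:
  assumes ab: "a < s0" "s0 < b" and cd: "c < t0" "t0 < d"
    and cont: "continuous_on {a..b} \<alpha>" "continuous_on {c..d} \<beta>"
    and zero: "\<And>s t. s \<in> {a..b} \<Longrightarrow> t \<in> {c..d} \<Longrightarrow> \<alpha> s = \<beta> t \<longleftrightarrow> s = s0 \<and> t = t0"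
    and tr: "transversal_at \<alpha> \<beta> s0 t0"
  shows "\<exists>k::int. rect_degree (\<lambda>s t. \<alpha> s - \<beta> t) a b c d = of_int k \<and> odd k"
proof -
  let ?G = "\<lambda>s t. \<alpha> s - \<beta> t"
  have "\<alpha> s0 = \<beta> t0" using zero[of s0 t0] ab cd by auto
  from rect_degree_local_odd[OF ab cd cont this tr]
  obtain r k where r: "0 < r" "a < s0 - r" "s0 + r < b" "c < t0 - r" "t0 + r < d"
    and k: "rect_degree ?G (s0 - r) (s0 + r) (t0 - r) (t0 + r) = of_int k" "odd (k::int)" .
  have free: "rect_degree ?G a' b' c' d' = 0"
    if "a \<le> a'" "a' \<le> b'" "b' \<le> b" "c \<le> c'" "c' \<le> d'" "d' \<le> d"
      "s0 \<notin> {a'..b'} \<or> t0 \<notin> {c'..d'}" for a' b' c' d'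
  proof (rule rect_degree_zero_free)
    show "continuous_on ({a'..b'} \<times> {c'..d'}) (\<lambda>(s, t). \<alpha> s - \<beta> t)"
      unfolding case_prod_unfold
      by (intro continuous_on_diff continuous_on_compose2[OF cont(1)] continuous_on_compose2[OF cont(2)]
            continuous_on_fst continuous_on_snd continuous_on_id) (use that in auto)
  qed (use that zero in \<open>force+\<close>)
  have ca: "continuous_on S (\<lambda>s. \<alpha> s - y)" if "S \<subseteq> {a..b}" for S y
    by (intro continuous_on_diff continuous_on_const continuous_on_subset[OF cont(1) that])
  have cb: "continuous_on S (\<lambda>t. x - \<beta> t)" if "S \<subseteq> {c..d}" for S x
    by (intro continuous_on_diff continuous_on_const continuous_on_subset[OF cont(2) that])
  have "rect_degree ?G a b c d = rect_degree ?G a (s0 - r) c d + rect_degree ?G (s0 - r) b c d"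
    using r ab cd zero by (intro rect_degree_split_fst ca) auto
  moreover have "rect_degree ?G (s0 - r) b c d = rect_degree ?G (s0 - r) (s0 + r) c d + rect_degree ?G (s0 + r) b c d"
    using r ab cd zero by (intro rect_degree_split_fst ca) auto
  moreover have "rect_degree ?G (s0 - r) (s0 + r) c d
      = rect_degree ?G (s0 - r) (s0 + r) c (t0 - r) + rect_degree ?G (s0 - r) (s0 + r) (t0 - r) d"
    using r ab cd zero by (intro rect_degree_split_snd cb) auto
  moreover have "rect_degree ?G (s0 - r) (s0 + r) (t0 - r) d
      = rect_degree ?G (s0 - r) (s0 + r) (t0 - r) (t0 + r) + rect_degree ?G (s0 - r) (s0 + r) (t0 + r) d"
    using r ab cd zero by (intro rect_degree_split_snd cb) auto
  moreover have "rect_degree ?G a (s0 - r) c d = 0" "rect_degree ?G (s0 + r) b c d = 0"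
    "rect_degree ?G (s0 - r) (s0 + r) c (t0 - r) = 0" "rect_degree ?G (s0 - r) (s0 + r) (t0 + r) d = 0"
    using r ab cd by (intro free; auto)+
  ultimately have "rect_degree ?G a b c d = of_int k" using k(1) by simp
  then show ?thesis using k(2) by blast
qed

text \<open>Vertical cuts that miss all zeros split the rectangle into strips with one zero each; this is
  possible because different zeros have different first coordinates.\<close>

lemma rect_degree_parity:
  assumes "a \<le> b" "c \<le> d"
    and cont: "continuous_on {a..b} \<alpha>" "continuous_on {c..d} \<beta>"
    and Z: "Z = {(s, t) \<in> {a..b} \<times> {c..d}. \<alpha> s = \<beta> t}" "finite Z" "inj_on fst Z"
    and interior: "\<And>s t. (s, t) \<in> Z \<Longrightarrow> a < s \<and> s < b \<and> c < t \<and> t < d"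
    and tr: "\<And>s t. (s, t) \<in> Z \<Longrightarrow> transversal_at \<alpha> \<beta> s t"
  shows "\<exists>k::int. rect_degree (\<lambda>s t. \<alpha> s - \<beta> t) a b c d = of_int k \<and> (even k \<longleftrightarrow> even (card Z))"
  using assms
proof (induction "card Z" arbitrary: a b Z rule: less_induct)
  case less
  let ?G = "\<lambda>s t. \<alpha> s - \<beta> t"
  note Z = less.prems(5-7) and int = less.prems(8)
  consider "card Z = 0" | "card Z = 1" | "2 \<le> card Z" by linarith
  then show ?case
  proof cases
    case 1
    then have "Z = {}" using Z(2) by simp
    have "rect_degree ?G a b c d = 0"
    proof (rule rect_degree_zero_free)
      show "continuous_on ({a..b} \<times> {c..d}) (\<lambda>(s, t). \<alpha> s - \<beta> t)"
        unfolding case_prod_unfold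
        by (intro continuous_on_diff continuous_on_compose2[OF less.prems(3)]
              continuous_on_compose2[OF less.prems(4)] continuous_on_fst continuous_on_snd continuous_on_id) auto
    qed (use \<open>Z = {}\<close> Z(1) less.prems in auto)
    then show ?thesis using 1 by (intro exI[of _ 0]) auto
  next
    case 2
    then obtain s0 t0 where z: "Z = {(s0, t0)}" by (metis card_1_singletonE surj_pair)
    have "\<alpha> s = \<beta> t \<longleftrightarrow> s = s0 \<and> t = t0" if "s \<in> {a..b}" "t \<in> {c..d}" for s t
    proof -
      have "(s, t) \<in> Z \<longleftrightarrow> \<alpha> s = \<beta> t" using Z(1) that by auto
      then show ?thesis using z by auto
    qed
    then show ?thesis
      using rect_degree_single_crossing[of a s0 b c t0 d \<alpha> \<beta>] less.prems(3,4,9) int[of s0 t0] z 2 by auto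
  next
    case 3
    then obtain z1 z2 where "z1 \<in> Z" "z2 \<in> Z" "z1 \<noteq> z2"
      by (metis card_le_Suc0_iff_eq Z(2) not_less_eq_eq numeral_2_eq_2)
    then have "fst z1 \<noteq> fst z2" using Z(3) by (auto dest: inj_onD)
    then obtain p q where pq: "p \<in> Z" "q \<in> Z" "fst p < fst q"
      using \<open>z1 \<in> Z\<close> \<open>z2 \<in> Z\<close> by (metis linorder_neqE_linordered_idom)
    \<comment> \<open>Finitely many zeros cannot block every cut between \<open>p\<close> and
      \<open>q\<close>. These two end up on different sides, so both strips have fewer
      zeros.\<close>
    have "infinite ({fst p<..<fst q} - fst ` Z)"
      using pq(3) Z(2) by (intro Diff_infinite_finite) (auto simp: infinite_Ioo)
    then obtain m where m: "fst p < m" "m < fst q" "m \<notin> fst ` Z"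
      by (metis (no_types, lifting) DiffE ex_in_conv finite.emptyI greaterThanLessThan_iff)
    have am: "a < m" "m < b" using m int[of "fst p" "snd p"] int[of "fst q" "snd q"] pq by auto
    define Z1 where "Z1 = {(s, t) \<in> {a..m} \<times> {c..d}. \<alpha> s = \<beta> t}"
    define Z2 where "Z2 = {(s, t) \<in> {m..b} \<times> {c..d}. \<alpha> s = \<beta> t}"
    have un: "Z = Z1 \<union> Z2" and sub: "Z1 \<subseteq> Z" "Z2 \<subseteq> Z"
      using am by (auto simp: Z(1) Z1_def Z2_def)
    have nm: "s \<noteq> m" if "(s, t) \<in> Z" for s t using m(3) that by force
    have disj: "Z1 \<inter> Z2 = {}"
      using nm sub by (fastforce simp: Z1_def Z2_def)
    have "p \<notin> Z2" "q \<notin> Z1" using m by (auto simp: Z1_def Z2_def)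
    then have "Z1 \<subset> Z" "Z2 \<subset> Z" using sub pq by auto
    then have card: "card Z1 < card Z" "card Z2 < card Z" by (auto intro: psubset_card_mono Z(2))
    have "\<exists>k::int. rect_degree ?G a m c d = of_int k \<and> (even k \<longleftrightarrow> even (card Z1))"
    proof (rule less.hyps[OF card(1)])
      show "a < s \<and> s < m \<and> c < t \<and> t < d" if "(s, t) \<in> Z1" for s t
      proof -
        have "s \<le> m" using that by (auto simp: Z1_def)
        then show ?thesis using int[of s t] nm[of s t] that sub by force
      qed
    qed (use am less.prems sub Z1_def in \<open>auto intro: continuous_on_subset inj_on_subset finite_subset\<close>)
    moreover have "\<exists>k::int. rect_degree ?G m b c d = of_int k \<and> (even k \<longleftrightarrow> even (card Z2))"
    proof (rule less.hyps[OF card(2)])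
      show "m < s \<and> s < b \<and> c < t \<and> t < d" if "(s, t) \<in> Z2" for s t
      proof -
        have "m \<le> s" using that by (auto simp: Z2_def)
        then show ?thesis using int[of s t] nm[of s t] that sub by force
      qed
    qed (use am less.prems sub Z2_def in \<open>auto intro: continuous_on_subset inj_on_subset finite_subset\<close>)
    moreover have "rect_degree ?G a b c d = rect_degree ?G a m c d + rect_degree ?G m b c d"
    proof (rule rect_degree_split_fst)
      show "?G s c \<noteq> 0 \<and> ?G s d \<noteq> 0" if "s \<in> {a..b}" for s
        using int[of s c] int[of s d] that less.prems(2) by (auto simp: Z(1))
    qed (use am less.prems in \<open>auto intro!: continuous_on_diff continuous_on_const\<close>)
    moreover have "card Z = card Z1 + card Z2"
      unfolding un by (rule card_Un_disjoint) (use disj sub Z(2) finite_subset in auto)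
    ultimately show ?thesis by (metis even_add of_int_add)
  qed
qed

section \<open>Crossings of disjoint edges\<close>

definition to_complex :: "real^2 \<Rightarrow> complex" where
  "to_complex p = Complex (p $ 1) (p $ 2)"

lemma linear_to_complex: "linear to_complex"
  by (rule linearI) (auto simp: to_complex_def complex_eq_iff)

lemma inj_to_complex: "inj to_complex"
  by (rule injI) (auto simp: to_complex_def complex_eq_iff vec_eq_iff forall_2)

lemma to_complex_eq_iff [simp]: "to_complex p = to_complex q \<longleftrightarrow> p = q"
  using inj_to_complex by (rule inj_eq)

lemma bounded_linear_to_complex: "bounded_linear to_complex"
  using linear_to_complex by (rule linear_conv_bounded_linear[THEN iffD1])

lemma linepath_vertex_nth:
  "linepath (vertex_point a) (vertex_point b) t $ v
     = (1 - t) * of_bool (v = a) + t * of_bool (v = b)"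
  by (auto simp: linepath_def vertex_point_def axis_def)

definition edge_curve :: "(real^'v::finite \<Rightarrow> real^2) \<Rightarrow> 'v \<Rightarrow> 'v \<Rightarrow> real \<Rightarrow> complex" where
  "edge_curve f a b t = to_complex (f (linepath (vertex_point a) (vertex_point b) t))"

lemma edge_arc_eq: "edge_arc {a, b} = linepath (vertex_point a) (vertex_point b) ` {0..1}"
  by (simp add: edge_arc_def segment_convex_hull[symmetric] linepath_image_01)

lemma linepath_in_edge_arc:
  "t \<in> {0..1} \<Longrightarrow> linepath (vertex_point a) (vertex_point b) t \<in> edge_arc {a, b}"
  by (simp add: edge_arc_eq)

lemma linepath_vertex_inj:
  assumes "a \<noteq> b" "linepath (vertex_point a) (vertex_point b) s = linepath (vertex_point a) (vertex_point b) t"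
  shows "s = t"
  using arg_cong[OF assms(2), of "\<lambda>x. x $ b"] assms(1) by (simp add: linepath_vertex_nth)

text \<open>The coordinates at \<open>a\<close> and \<open>b\<close> both vanish on the second arc,
  but never both on the first.\<close>

lemma edge_arcs_disjoint:
  assumes "{a, b} \<inter> {x, y} = {}"
  shows "edge_arc {a, b} \<inter> edge_arc {x, y} = {}"
proof -
  have False if p: "p \<in> edge_arc {a, b}" "p \<in> edge_arc {x, y}" for p
  proof -
    obtain s t where s: "p = linepath (vertex_point a) (vertex_point b) s"
      and t: "p = linepath (vertex_point x) (vertex_point y) t"
      using p unfolding edge_arc_eq by blast
    have "p $ a = 0" "p $ b = 0"
      using assms unfolding t linepath_vertex_nth by auto
    then show False unfolding s linepath_vertex_nth by (cases "a = b") auto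
  qed
  then show ?thesis by blast
qed

lemma vertex_point_notin_edge_arc:
  assumes "v \<notin> {a, b}"
  shows "vertex_point v \<notin> edge_arc {a, b}"
  using edge_arcs_disjoint[of v v a b] assms linepath_in_edge_arc[of 0 v v] by auto

lemma inj_vertex_point: "inj vertex_point"
  by (rule injI) (auto simp: vertex_point_def axis_eq_axis)

text \<open>The support of a point reveals the edge in whose interior it lies. This identifies the
  edge hidden behind the existential quantifier in \<open>edge_tangent\<close>.\<close>

lemma support_linepath_vertex:
  assumes "0 < t" "t < 1"
  shows "{v. linepath (vertex_point a) (vertex_point b) t $ v \<noteq> 0} = {a, b}"
proof -
  have "1 - t + t \<noteq> 0" by simp
  then show ?thesis using assms by (auto simp: linepath_vertex_nth)
qed

lemma linepath_support_cases:
  assumes "{v. linepath (vertex_point a) (vertex_point b) t $ v \<noteq> 0} = {c, d}" "c \<noteq> d" "a \<noteq> b"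
  shows "{a, b} = {c, d}" "t \<noteq> 0" "t \<noteq> 1"
proof -
  have "{v. linepath (vertex_point a) (vertex_point b) t $ v \<noteq> 0}
      = (if t \<noteq> 1 then {a} else {}) \<union> (if t \<noteq> 0 then {b} else {})"
    using assms(3) by (auto simp: linepath_vertex_nth)
  with assms show "{a, b} = {c, d}" "t \<noteq> 0" "t \<noteq> 1"
    by (auto split: if_splits)
qed

section \<open>Generic immersions of a graph and their double points\<close>

locale generic_immersion =
  fixes E :: "'v::finite set set" and f :: "real^'v \<Rightarrow> real^2"
  assumes simple: "{a, b} \<in> E \<Longrightarrow> a \<noteq> b"
    and generic: "plane_generic_immersion E f"
begin

lemma edge_arc_subset: "e \<in> E \<Longrightarrow> edge_arc e \<subseteq> realization E"
  by (auto simp: realization_def)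

lemma linepath_in_realization:
  "{a, b} \<in> E \<Longrightarrow> t \<in> {0..1} \<Longrightarrow> linepath (vertex_point a) (vertex_point b) t \<in> realization E"
  using edge_arc_subset linepath_in_edge_arc by blast

lemma vertex_in_realization: "vertex_point v \<in> realization E"
  by (auto simp: realization_def)

lemma continuous_on_edge_curve:
  assumes "{a, b} \<in> E"
  shows "continuous_on {0..1} (edge_curve f a b)"
proof -
  have "continuous_on (realization E) f"
    using generic by (simp add: plane_generic_immersion_def graph_immersion_def)
  then have "continuous_on {0..1} (\<lambda>t. f (linepath (vertex_point a) (vertex_point b) t))"
    by (rule continuous_on_compose2) (auto intro: linepath_in_realization[OF assms])
  then show ?thesis
    unfolding edge_curve_def by (rule bounded_linear.continuous_on[OF bounded_linear_to_complex])
qed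

text \<open>Replaces the existential preimages in \<open>transversal_double_point\<close> by two
  given ones, exchanging the tangents if necessary. The last conclusion excludes a third
  preimage.\<close>

lemma double_point:
  assumes "x \<in> realization E" "y \<in> realization E" "x \<noteq> y" "f x = f y"
  obtains S T where "edge_tangent E f x S" "edge_tangent E f y T" "S \<noteq> T" "independent {S, T}"
    "{z \<in> realization E. f z = f x} = {x, y}"
proof -
  have "f x \<in> multiple_points E f"
    unfolding multiple_points_def using assms by auto
  then have "transversal_double_point E f (f x)"
    using generic by (simp add: plane_generic_immersion_def)
  then obtain x' y' S T where *: "x' \<noteq> y'" "{z \<in> realization E. f z = f x} = {x', y'}"
      "edge_tangent E f x' S" "edge_tangent E f y' T" "S \<noteq> T" "independent {S, T}"
    unfolding transversal_double_point_def by blast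
  have "x \<in> {x', y'}" "y \<in> {x', y'}" using assms *(2) by auto
  then consider "x = x'" "y = y'" | "x = y'" "y = x'" using assms(3) by auto
  then show ?thesis
  proof cases
    case 1 then show ?thesis using * by (intro that) auto
  next
    case 2 then show ?thesis using * by (intro that[of T S]) (auto simp: insert_commute)
  qed
qed

lemma edge_tangent_support:
  assumes "edge_tangent E f x S"
  obtains a b where "{a, b} \<in> E" "a \<noteq> b" "{v. x $ v \<noteq> 0} = {a, b}"
  using assms support_linepath_vertex simple unfolding edge_tangent_def by metis

text \<open>Preimages of a double point are interior to edges and have two nonzero coordinates,
  whereas a vertex has one.\<close>

lemma vertex_not_multiple:
  assumes "x \<in> realization E" "x \<noteq> vertex_point v"
  shows "f x \<noteq> f (vertex_point v)"
proof
  assume "f x = f (vertex_point v)"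
  then obtain T where "edge_tangent E f (vertex_point v) T"
    using double_point[OF assms(1) vertex_in_realization assms(2)] by metis
  then obtain a b where ab: "a \<noteq> b" "{u. vertex_point v $ u \<noteq> (0::real)} = {a, b}"
    by (rule edge_tangent_support)
  have "{u. vertex_point v $ u \<noteq> (0::real)} = {v}" by (auto simp: vertex_point_def axis_def)
  with ab show False by auto
qed

text \<open>\<open>edge_tangent\<close> may use the opposite orientation of the edge. The support
  leaves just these two orientations, so the factor is 1 or -1.\<close>

lemma edge_tangent_edge_curve:
  assumes "edge_tangent E f (linepath (vertex_point a) (vertex_point b) s) S" "{a, b} \<in> E" "s \<in> {0..1}"
  obtains \<sigma> :: real where "0 < s" "s < 1" "\<sigma> \<noteq> 0"
    "(edge_curve f a b has_vector_derivative \<sigma> *\<^sub>R to_complex S) (at s)"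
proof -
  let ?l = "\<lambda>a b. linepath (vertex_point a) (vertex_point b)"
  obtain c d t where cd: "{c, d} \<in> E" "0 < t" "t < 1" "?l a b s = ?l c d t"
    and der: "((f \<circ> ?l c d) has_vector_derivative S) (at t)"
    using assms(1) unfolding edge_tangent_def by blast
  have "c \<noteq> d" "a \<noteq> b" using cd(1) assms(2) simple by auto
  have "{v. ?l a b s $ v \<noteq> 0} = {c, d}"
    unfolding cd(4) using cd(2,3) by (rule support_linepath_vertex)
  note supp = linepath_support_cases[OF this \<open>c \<noteq> d\<close> \<open>a \<noteq> b\<close>]
  then have s: "0 < s" "s < 1" using assms(3) by auto
  have cder: "(edge_curve f c d has_vector_derivative to_complex S) (at t)"
    using bounded_linear.has_vector_derivative[OF bounded_linear_to_complex der]
    by (simp add: edge_curve_def[abs_def] o_def)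
  have "a = c \<and> b = d \<or> a = d \<and> b = c" using supp(1) by (auto simp: doubleton_eq_iff)
  then show ?thesis
  proof
    assume ac: "a = c \<and> b = d"
    then have "s = t" using cd(4) linepath_vertex_inj[OF \<open>a \<noteq> b\<close>] by simp
    then show ?thesis using s cder ac by (intro that[of 1]) auto
  next
    assume ac: "a = d \<and> b = c"
    then have t: "t = 1 - s"
      using arg_cong[OF cd(4), of "\<lambda>x. x $ b"] \<open>a \<noteq> b\<close> by (simp add: linepath_vertex_nth)
    have "edge_curve f a b r = edge_curve f c d (1 - r)" for r
      using ac unfolding edge_curve_def linepath_def by (simp add: add.commute)
    then have "edge_curve f a b = edge_curve f c d \<circ> (\<lambda>r. 1 - r)" by auto
    moreover have "(edge_curve f c d \<circ> (\<lambda>r. 1 - r) has_vector_derivative (-1) *\<^sub>R to_complex S) (at s)"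
    proof (rule vector_diff_chain_at)
      show "((\<lambda>r. 1 - r) has_vector_derivative - 1) (at s)"
        unfolding has_real_derivative_iff_has_vector_derivative[symmetric]
        by (auto intro!: derivative_eq_intros)
    qed (use cder t in simp)
    ultimately show ?thesis using s by (intro that[of "-1"]) auto
  qed
qed

lemma independent_scaled:
  assumes "S \<noteq> T" "independent {S, T}" "\<sigma> \<noteq> 0" "\<tau> \<noteq> 0"
    "x *\<^sub>R (\<sigma> *\<^sub>R to_complex S) - y *\<^sub>R (\<tau> *\<^sub>R to_complex T) = 0"
  shows "x = 0 \<and> y = 0"
proof -
  define u where "u v = (if v = S then x * \<sigma> else - (y * \<tau>))" for v
  have "to_complex (\<Sum>v\<in>{S, T}. u v *\<^sub>R v) = to_complex 0"
    using assms(1,5) by (simp add: u_def linear_diff[OF linear_to_complex] linear_scale[OF linear_to_complex]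
        linear_0[OF linear_to_complex] del: to_complex_eq_iff)
  then have "(\<Sum>v\<in>{S, T}. u v *\<^sub>R v) = 0" by simp
  then have "u S = 0" "u T = 0"
    using independentD[OF assms(2), of "{S, T}" u] by auto
  then show ?thesis using assms(1,3,4) by (auto simp: u_def)
qed

text \<open>Zeros of the difference on the unit square correspond to common image points. Genericity
  makes them finite in number, interior and transversal, and a zero is determined by its image
  point, so no two share a first coordinate.\<close>

lemma crossing_parity:
  assumes e: "{a, b} \<in> E" "{x, y} \<in> E" and disj: "{a, b} \<inter> {x, y} = {}"
  shows "\<exists>k::int. rect_degree (\<lambda>s t. edge_curve f a b s - edge_curve f x y t) 0 1 0 1 = of_int k
           \<and> (even k \<longleftrightarrow> even (card (f ` edge_arc {a, b} \<inter> f ` edge_arc {x, y})))"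
proof -
  let ?l = "linepath (vertex_point a) (vertex_point b)" and ?m = "linepath (vertex_point x) (vertex_point y)"
  define Z where "Z = {(s, t) \<in> {0..1} \<times> {0..1}. edge_curve f a b s = edge_curve f x y t}"
  have ne: "a \<noteq> b" "x \<noteq> y" using e simple by auto
  have Z: "s \<in> {0..1}" "t \<in> {0..1}" "f (?l s) = f (?m t)" if "(s, t) \<in> Z" for s t
    using that by (auto simp: Z_def edge_curve_def)
  have lm: "?l s \<noteq> ?m t" if "s \<in> {0..1}" "t \<in> {0..1}" for s t
    using edge_arcs_disjoint[OF disj] linepath_in_edge_arc that by (metis disjoint_iff)
  have dbl: "\<exists>S T. edge_tangent E f (?l s) S \<and> edge_tangent E f (?m t) T \<and> S \<noteq> T \<and> independent {S, T}
      \<and> {z \<in> realization E. f z = f (?l s)} = {?l s, ?m t}" if "(s, t) \<in> Z" for s t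
    by (rule double_point[OF linepath_in_realization[OF e(1) Z(1)[OF that]]
          linepath_in_realization[OF e(2) Z(2)[OF that]] lm[OF Z(1,2)[OF that]] Z(3)[OF that]])
       (intro exI conjI)
  \<comment> \<open>The fibre consists of one point on each of two disjoint arcs, so a second zero
    over the same image point has the same two preimages.\<close>
  have uniq: "s = s' \<and> t = t'" if z: "(s, t) \<in> Z" "(s', t') \<in> Z" and "f (?l s) = f (?l s')" for s t s' t'
  proof -
    have "?l s' \<in> {z \<in> realization E. f z = f (?l s)}" "?m t' \<in> {z \<in> realization E. f z = f (?l s)}"
      using Z[OF z(2)] that(3) linepath_in_realization e by auto
    then have "?l s' \<in> {?l s, ?m t}" "?m t' \<in> {?l s, ?m t}" using dbl[OF z(1)] by auto
    then have "?l s' = ?l s" "?m t' = ?m t" using lm Z[OF z(1)] Z[OF z(2)] by fastforce+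
    then show ?thesis using linepath_vertex_inj ne by metis
  qed
  have bij: "bij_betw (\<lambda>(s, t). f (?l s)) Z (f ` edge_arc {a, b} \<inter> f ` edge_arc {x, y})"
    unfolding bij_betw_def
  proof
    show "inj_on (\<lambda>(s, t). f (?l s)) Z"
      using uniq by (auto simp: inj_on_def)
    show "(\<lambda>(s, t). f (?l s)) ` Z = f ` edge_arc {a, b} \<inter> f ` edge_arc {x, y}" (is "?A = ?B")
    proof
      show "?A \<subseteq> ?B"
      proof (clarify, intro IntI)
        fix s t assume z: "(s, t) \<in> Z"
        show "f (?l s) \<in> f ` edge_arc {a, b}" using Z[OF z] by (intro imageI linepath_in_edge_arc)
        show "f (?l s) \<in> f ` edge_arc {x, y}"
          unfolding Z(3)[OF z] using Z[OF z] by (intro imageI linepath_in_edge_arc)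
      qed
      show "?B \<subseteq> ?A"
      proof
        fix p assume "p \<in> ?B"
        then obtain s t where "s \<in> {0..1}" "t \<in> {0..1}" "p = f (?l s)" "p = f (?m t)"
          by (auto simp: edge_arc_eq)
        then have "(s, t) \<in> Z" "p = (\<lambda>(s, t). f (?l s)) (s, t)" by (auto simp: Z_def edge_curve_def)
        then show "p \<in> ?A" by blast
      qed
    qed
  qed
  have "f (?l s) \<in> multiple_points E f" if "(s, t) \<in> Z" for s t
    unfolding multiple_points_def mem_Collect_eq
    using linepath_in_realization[OF e(1) Z(1)[OF that]] linepath_in_realization[OF e(2) Z(2)[OF that]]
      lm[OF Z(1,2)[OF that]] Z(3)[OF that, symmetric]
    by (intro bexI[of _ "?l s"] bexI[of _ "?m t"] conjI) simp_all
  then have "f ` edge_arc {a, b} \<inter> f ` edge_arc {x, y} \<subseteq> multiple_points E f"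
    unfolding bij_betw_imp_surj_on[OF bij, symmetric] by auto
  then have fin: "finite Z"
    using generic bij_betw_finite[OF bij] finite_subset unfolding plane_generic_immersion_def by blast
  have crossing: "0 < s \<and> s < 1 \<and> 0 < t \<and> t < 1 \<and> transversal_at (edge_curve f a b) (edge_curve f x y) s t"
    if z: "(s, t) \<in> Z" for s t
  proof -
    obtain S T where ST: "edge_tangent E f (?l s) S" "edge_tangent E f (?m t) T" "S \<noteq> T" "independent {S, T}"
      using dbl[OF z] by blast
    obtain \<sigma> where 1: "0 < s" "s < 1" "\<sigma> \<noteq> 0" "(edge_curve f a b has_vector_derivative \<sigma> *\<^sub>R to_complex S) (at s)"
      using edge_tangent_edge_curve[OF ST(1) e(1) Z(1)[OF z]] .
    obtain \<tau> where 2: "0 < t" "t < 1" "\<tau> \<noteq> 0" "(edge_curve f x y has_vector_derivative \<tau> *\<^sub>R to_complex T) (at t)"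
      using edge_tangent_edge_curve[OF ST(2) e(2) Z(2)[OF z]] .
    show ?thesis
      using 1 2 independent_scaled[OF ST(3,4) 1(3) 2(3)] unfolding transversal_at_def by blast
  qed
  have inj: "inj_on fst Z"
  proof (rule inj_onI)
    fix z w assume "z \<in> Z" "w \<in> Z" "fst z = fst w"
    then show "z = w" using uniq by (cases z; cases w) auto
  qed
  have "\<exists>k::int. rect_degree (\<lambda>s t. edge_curve f a b s - edge_curve f x y t) 0 1 0 1 = of_int k
           \<and> (even k \<longleftrightarrow> even (card Z))"
    by (rule rect_degree_parity[OF _ _ continuous_on_edge_curve continuous_on_edge_curve Z_def fin inj])
       (use e crossing in auto)
  then show ?thesis using bij_betw_same_card[OF bij] by simp
qed

section \<open>Turning of an edge as seen from a vertex\<close>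

lemma
  assumes e: "{a, b} \<in> E" and v: "v \<notin> {a, b}"
  defines "z \<equiv> \<lambda>u. to_complex (f (vertex_point u))"
  shows edge_curve_avoids_vertex: "\<And>t. t \<in> {0..1} \<Longrightarrow> edge_curve f a b t \<noteq> z v"
    and exp_turning_edge: "exp (2 * of_real pi * \<i> * turning (\<lambda>t. edge_curve f a b t - z v) 0 1)
       = (z b - z v) / (z a - z v)"
proof -
  show avoid: "edge_curve f a b t \<noteq> z v" if "t \<in> {0..1}" for t
  proof -
    have "linepath (vertex_point a) (vertex_point b) t \<noteq> vertex_point v"
      using vertex_point_notin_edge_arc[OF v] linepath_in_edge_arc[OF that] by metis
    then show ?thesis
      using vertex_not_multiple[OF linepath_in_realization[OF e that]] by (simp add: edge_curve_def z_def)
  qed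
  have "exp (2 * of_real pi * \<i> * turning (\<lambda>t. edge_curve f a b t - z v) 0 1)
      = (edge_curve f a b 1 - z v) / (edge_curve f a b 0 - z v)"
    using avoid by (intro exp_turning continuous_on_diff continuous_on_edge_curve[OF e]) auto
  then show "exp (2 * of_real pi * \<i> * turning (\<lambda>t. edge_curve f a b t - z v) 0 1)
       = (z b - z v) / (z a - z v)"
    by (simp add: edge_curve_def z_def linepath_def)
qed

lemma vertex_images_distinct: "u \<noteq> v \<Longrightarrow> f (vertex_point u) \<noteq> f (vertex_point v)"
  by (rule vertex_not_multiple[OF vertex_in_realization]) (simp add: inj_eq[OF inj_vertex_point])

text \<open>\<open>n v (a, b)\<close> counts the full turns of the edge \<open>ab\<close> as seen from \<open>v\<close>, relative to fixed arguments
  \<open>\<phi> v a\<close>, \<open>\<phi> v b\<close> of the directions from \<open>v\<close> to the ends.  Since \<open>\<phi> u v\<close> and \<open>\<phi> v u\<close> differ by \<open>\<plusminus>\<pi>\<close>,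
  with the sign given by \<open>ord\<close>, the remaining term is the crossing parity of the chords \<open>ab\<close> and
  \<open>xy\<close> in a convex drawing.\<close>

lemma crossing_parity_formula:
  fixes ord :: "'v \<Rightarrow> nat"
  assumes "inj ord"
  obtains n :: "'v \<Rightarrow> 'v \<times> 'v \<Rightarrow> int" where
    "\<And>a b x y. {a, b} \<in> E \<Longrightarrow> {x, y} \<in> E \<Longrightarrow> {a, b} \<inter> {x, y} = {} \<Longrightarrow>
       ord a < ord b \<Longrightarrow> ord x < ord y \<Longrightarrow>
       even (int (card (f ` edge_arc {a, b} \<inter> f ` edge_arc {x, y}))
             + of_bool (ord a < ord x \<and> ord x < ord b \<and> ord b < ord y \<or>
                        ord x < ord a \<and> ord a < ord y \<and> ord y < ord b)
             + n a (x, y) + n b (x, y) + n x (a, b) + n y (a, b))"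
proof -
  define z where "z u = to_complex (f (vertex_point u))" for u
  \<comment> \<open>One logarithm is chosen for each unordered pair, in the direction from the
    smaller to the larger vertex, and the opposite direction adds i pi to it. With \<open>Ln\<close>
    in both directions the sign of the difference would depend on the position of the
    points.\<close>
  define \<phi> where "\<phi> u v = (if ord u < ord v then Ln (z v - z u) else Ln (z u - z v) + \<i> * pi)" for u v
  have z: "z u \<noteq> z v" if "u \<noteq> v" for u v
    using vertex_images_distinct[OF that] by (simp add: z_def)
  have exp_phi: "exp (\<phi> u v) = z v - z u" if "u \<noteq> v" for u v
    using z[OF that] z[OF that[symmetric]] by (auto simp: \<phi>_def exp_add)
  have flip: "\<phi> v u - \<phi> u v = \<i> * pi * (if ord u < ord v then 1 else -1)" if "u \<noteq> v" for u v
  proof -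
    have "ord u \<noteq> ord v" using that \<open>inj ord\<close> by (simp add: inj_eq)
    then show ?thesis by (auto simp: \<phi>_def)
  qed
  define turn where "turn v p = turning (\<lambda>t. edge_curve f (fst p) (snd p) t - z v) 0 1" for v p
  have "\<exists>m::int. 2 * of_real pi * \<i> * turn v (a, b) = \<phi> v b - \<phi> v a + 2 * of_int m * of_real pi * \<i>"
    if "{a, b} \<in> E" "v \<notin> {a, b}" for v a b
  proof -
    have "exp (2 * of_real pi * \<i> * turn v (a, b)) = (z b - z v) / (z a - z v)"
      using exp_turning_edge[OF that] by (simp add: turn_def z_def)
    also have "\<dots> = exp (\<phi> v b - \<phi> v a)" using that exp_phi[of v a] exp_phi[of v b] by (auto simp: exp_diff)
    finally show ?thesis unfolding exp_eq by simp
  qed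
  then have "\<forall>v p. \<exists>m::int. {fst p, snd p} \<in> E \<longrightarrow> v \<notin> {fst p, snd p} \<longrightarrow>
      2 * of_real pi * \<i> * turn v p = \<phi> v (snd p) - \<phi> v (fst p) + 2 * of_int m * of_real pi * \<i>"
    by (metis prod.collapse)
  then obtain n :: "'v \<Rightarrow> 'v \<times> 'v \<Rightarrow> int" where
    "\<forall>v p. {fst p, snd p} \<in> E \<longrightarrow> v \<notin> {fst p, snd p} \<longrightarrow>
      2 * of_real pi * \<i> * turn v p = \<phi> v (snd p) - \<phi> v (fst p) + 2 * of_int (n v p) * of_real pi * \<i>"
    by metis
  then have n: "2 * of_real pi * \<i> * turn v (a, b) = \<phi> v b - \<phi> v a + 2 * of_int (n v (a, b)) * of_real pi * \<i>"
    if "{a, b} \<in> E" "v \<notin> {a, b}" for v a b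
    using that by (metis fst_conv snd_conv)
  show ?thesis
  proof (rule that)
    fix a b x y
    assume e: "{a, b} \<in> E" "{x, y} \<in> E" and disj: "{a, b} \<inter> {x, y} = {}"
      and o: "ord a < ord b" "ord x < ord y"
    have notin: "x \<notin> {a, b}" "y \<notin> {a, b}" "a \<notin> {x, y}" "b \<notin> {x, y}" using disj by auto
    define s where "s u v = (if ord u < ord v then 1 else -1 :: int)" for u v
    have flip': "\<phi> v u - \<phi> u v = \<i> * pi * of_int (s u v)" if "u \<noteq> v" for u v
      using flip[OF that] by (simp add: s_def)
    obtain k :: int where
      k: "rect_degree (\<lambda>s t. edge_curve f a b s - edge_curve f x y t) 0 1 0 1 = of_int k"
      and even_k: "even k \<longleftrightarrow> even (card (f ` edge_arc {a, b} \<inter> f ` edge_arc {x, y}))"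
      using crossing_parity[OF e disj] by blast
    have ends: "edge_curve f u v 0 = z u" "edge_curve f u v 1 = z v" for u v
      by (simp_all add: edge_curve_def z_def linepath_def)
    have rev: "turning (\<lambda>t. z v - edge_curve f x y t) 0 1 = turn v (x, y)" if "v \<notin> {x, y}" for v
      using turning_uminus[of 0 1 "\<lambda>t. edge_curve f x y t - z v"]
        continuous_on_edge_curve[OF e(2)] edge_curve_avoids_vertex[OF e(2) that]
      by (simp add: turn_def z_def continuous_on_diff)
    \<comment> \<open>The sides in the order bottom, right, top, left: for \<open>t = 0\<close> and
      \<open>t = 1\<close> the edge \<open>ab\<close> is seen from \<open>x\<close> and
      \<open>y\<close>; for \<open>s = 1\<close> and \<open>s = 0\<close> the edge \<open>xy\<close>
      is seen from \<open>b\<close> and \<open>a\<close>, negated, which \<open>rev\<close>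
      repairs.\<close>
    have "of_int k = turn x (a, b) + turn b (x, y) - turn y (a, b) - turn a (x, y)"
      unfolding k[symmetric] rect_degree_def ends
      by (simp add: rev notin[simplified] turn_def)
    then have "2 * of_real pi * \<i> * of_int k = 2 * of_real pi * \<i> * turn x (a, b) + 2 * of_real pi * \<i> * turn b (x, y)
        - 2 * of_real pi * \<i> * turn y (a, b) - 2 * of_real pi * \<i> * turn a (x, y)"
      by (simp only: right_diff_distrib distrib_left)
    also have "\<dots> = (\<phi> x b - \<phi> b x) + (\<phi> a x - \<phi> x a) + (\<phi> b y - \<phi> y b) + (\<phi> y a - \<phi> a y)
        + 2 * of_int (n x (a, b) + n b (x, y) - n y (a, b) - n a (x, y)) * of_real pi * \<i>"
      unfolding n[OF e(1) notin(1)] n[OF e(1) notin(2)] n[OF e(2) notin(3)] n[OF e(2) notin(4)]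
      by (simp add: algebra_simps)
    also have "\<dots> = of_int (s b x + s x a + s y b + s a y
        + 2 * (n x (a, b) + n b (x, y) - n y (a, b) - n a (x, y))) * (\<i> * pi)"
      using notin by (subst (1 2 3 4) flip') (auto simp: algebra_simps)
    finally have "of_int (2 * k) * (\<i> * pi) = of_int (s b x + s x a + s y b + s a y
        + 2 * (n x (a, b) + n b (x, y) - n y (a, b) - n a (x, y))) * (\<i> * of_real pi)"
      by (simp add: algebra_simps)
    then have k_eq: "2 * k = s b x + s x a + s y b + s a y
        + 2 * (n x (a, b) + n b (x, y) - n y (a, b) - n a (x, y))"
      by (subst (asm) mult_cancel_right) (simp only: of_int_eq_iff, simp)
    \<comment> \<open>Since \<open>x\<close> precedes \<open>y\<close>, half of
      \<open>s a y + s x a\<close> is 1 if \<open>a\<close> lies between them and 0 otherwise; half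
      of \<open>s b x + s y b\<close> is -1 or 0 likewise for \<open>b\<close>. So \<open>j\<close>
      is odd iff exactly one of \<open>a\<close>, \<open>b\<close> lies between \<open>x\<close> and
      \<open>y\<close>.\<close>
    have "\<exists>j. s b x + s x a + s y b + s a y = 2 * j
        \<and> even (j + of_bool (ord a < ord x \<and> ord x < ord b \<and> ord b < ord y \<or>
                        ord x < ord a \<and> ord a < ord y \<and> ord y < ord b))"
    proof -
      have "ord a \<noteq> ord x" "ord a \<noteq> ord y" "ord b \<noteq> ord x" "ord b \<noteq> ord y"
        using notin \<open>inj ord\<close> by (auto simp: inj_eq)
      then show ?thesis
        using o unfolding s_def
        by (intro exI[of _ "(s b x + s x a + s y b + s a y) div 2"]) (auto simp: s_def)
    qed
    then obtain j where j: "s b x + s x a + s y b + s a y = 2 * j"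
      and "even (j + of_bool (ord a < ord x \<and> ord x < ord b \<and> ord b < ord y \<or>
                        ord x < ord a \<and> ord a < ord y \<and> ord y < ord b))" by blast
    moreover have "k = j + (n x (a, b) + n b (x, y) - n y (a, b) - n a (x, y))"
      using k_eq unfolding j by simp
    ultimately show "even (int (card (f ` edge_arc {a, b} \<inter> f ` edge_arc {x, y}))
             + of_bool (ord a < ord x \<and> ord x < ord b \<and> ord b < ord y \<or>
                        ord x < ord a \<and> ord a < ord y \<and> ord y < ord b)
             + n a (x, y) + n b (x, y) + n x (a, b) + n y (a, b))"
      using even_k by (simp only: even_add even_diff even_of_nat_iff) blast
  qed
qed

end

section \<open>The Petersen graph\<close>

text \<open>The vertices \<open>U i\<close> and \<open>V i\<close> are numbered \<open>i\<close> and \<open>i + 5\<close>; edges are written with increasing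
  numbers, so that unordered pairs become ordered ones.\<close>

definition edge_codes :: "(nat \<times> nat) list" where
  "edge_codes = [(0,1), (0,4), (0,5), (1,2), (1,6), (2,3), (2,7), (3,4), (3,8), (4,9),
                 (5,7), (5,8), (6,8), (6,9), (7,9)]"

definition vertex :: "nat \<Rightarrow> petersen_vertex" where
  "vertex k = (if k < 5 then U (of_nat k) else V (of_nat (k - 5)))"

definition edge :: "nat \<times> nat \<Rightarrow> petersen_vertex set" where
  "edge p = {vertex (fst p), vertex (snd p)}"

text \<open>A counterpart of distance 1 on codes that the simplifier can evaluate.\<close>

definition at_distance_1 :: "nat \<times> nat \<Rightarrow> nat \<times> nat \<Rightarrow> bool" where
  "at_distance_1 p q \<longleftrightarrow> {fst p, snd p} \<inter> {fst q, snd q} = {} \<and>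
     (\<exists>u\<in>{fst p, snd p}. \<exists>v\<in>{fst q, snd q}. (u, v) \<in> set edge_codes \<or> (v, u) \<in> set edge_codes)"

definition interlaced :: "nat \<times> nat \<Rightarrow> nat \<times> nat \<Rightarrow> bool" where
  "interlaced p q \<longleftrightarrow> fst p < fst q \<and> fst q < snd p \<and> snd p < snd q \<or>
                     fst q < fst p \<and> fst p < snd q \<and> snd q < snd p"

definition before :: "nat \<times> nat \<Rightarrow> nat \<times> nat \<Rightarrow> bool" where
  "before p q \<longleftrightarrow> fst p < fst q \<or> fst p = fst q \<and> snd p < snd q"

lemma UNIV_5: "(UNIV :: 5 set) = {0, 1, 2, 3, 4}"
proof -
  have "card {0, 1, 2, 3, 4 :: 5} = card (UNIV :: 5 set)" by simp
  then show ?thesis using card_subset_eq[of "UNIV :: 5 set" "{0, 1, 2, 3, 4}"] by simp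
qed

lemma lessThan_10: "{..<10::nat} = {0, 1, 2, 3, 4, 5, 6, 7, 8, 9}"
  by (auto simp: numeral_eq_Suc less_Suc_eq)

lemma range_5: "range (h :: 5 \<Rightarrow> 'a) = {h 0, h 1, h 2, h 3, h 4}"
  by (simp add: UNIV_5)

lemma bij_vertex: "bij_betw vertex {..<10} UNIV"
proof -
  have "vertex ` {..<10} = range U \<union> range V"
    by (simp add: lessThan_10 vertex_def range_5 Un_insert_left insert_commute)
  also have "\<dots> = UNIV" by (auto intro: petersen_vertex.exhaust)
  finally have "vertex ` {..<10} = UNIV" .
  moreover have "inj_on vertex {..<10}"
    unfolding lessThan_10 by (simp add: vertex_def)
  ultimately show ?thesis by (simp add: bij_betw_def)
qed

lemma petersen_edges_eq: "petersen_edges = edge ` set edge_codes"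
proof -
  \<comment> \<open>These numerals arise where the indices wrap around: \<open>4 + 1\<close>,
    \<open>3 + 2\<close> and \<open>4 + 2\<close>.\<close>
  have mod5: "(5::5) = 0" "(6::5) = 1"
    by simp_all
  show ?thesis
    by (simp add: petersen_edges_def range_5 edge_def edge_codes_def vertex_def mod5 insert_commute)
qed

text \<open>Every vertex lies on none or two of the edges at distance 1 from \<open>q\<close>.\<close>

lemma sum_at_distance_1_even:
  fixes g :: "nat \<Rightarrow> int"
  assumes "q \<in> set edge_codes"
  shows "even (\<Sum>p\<leftarrow>filter (\<lambda>p. at_distance_1 p q) edge_codes. g (fst p) + g (snd p))"
  using assms[unfolded edge_codes_def list.set insert_iff empty_iff simp_thms]
  by (elim disjE; simp add: at_distance_1_def edge_codes_def; presburger?)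

text \<open>The value is found by evaluation and belongs to the chosen numbering. Another order of
  the vertices may change it, but by \<open>crossing_parity_formula\<close> not its parity.\<close>

lemma count_interlaced:
  "(\<Sum>q\<leftarrow>edge_codes. \<Sum>p\<leftarrow>edge_codes.
      of_bool (interlaced p q \<and> before p q \<and> at_distance_1 p q)) = (21::int)"
  by (simp add: edge_codes_def interlaced_def before_def at_distance_1_def)

section \<open>Distance 1 in terms of codes\<close>

lemma graph_distance_eq_1_iff:
  "graph_distance E d e = 1 \<longleftrightarrow> d \<inter> e = {} \<and> (\<exists>x\<in>d. \<exists>y\<in>e. {x, y} \<in> E)"
proof
  let ?S = "{xs. graph_path E xs \<and> hd xs \<in> d \<and> last xs \<in> e}"
  assume dist: "graph_distance E d e = 1"
  have "x \<notin> e" if "x \<in> d" for x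
  proof
    assume "x \<in> e"
    then have "[x] \<in> ?S" using that by (simp add: graph_path_def)
    then have "graph_distance E d e \<le> enat (length [x] - 1)"
      unfolding graph_distance_def by (rule INF_lower)
    then show False using dist by (simp add: one_enat_def)
  qed
  then have disj: "d \<inter> e = {}" by blast
  have "\<exists>xs\<in>?S. length xs \<le> 2"
  proof (rule ccontr)
    assume "\<not> ?thesis"
    \<comment> \<open>Every joining path now has at least two edges; if there is none, the infimum
      is infinite.\<close>
    then have "2 \<le> graph_distance E d e"
      unfolding graph_distance_def by (intro INF_greatest) (auto simp: numeral_eq_enat not_le)
    then show False using dist by (simp add: one_enat_def numeral_eq_enat)
  qed
  then obtain xs where xs: "xs \<in> ?S" "length xs \<le> 2" by blast
  then have "xs \<noteq> []" by (simp add: graph_path_def)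
  then have "length xs \<noteq> 0" by simp
  then have "length xs = 1 \<or> length xs = 2" using xs(2) by linarith
  then have "(\<exists>x. xs = [x]) \<or> (\<exists>x y. xs = [x, y])"
    by (auto simp: numeral_2_eq_2 length_Suc_conv)
  then obtain x y where "xs = [x, y]" using xs disj by auto
  then have "x \<in> d" "y \<in> e" "{x, y} \<in> E" using xs by (auto simp: graph_path_def)
  then show "d \<inter> e = {} \<and> (\<exists>x\<in>d. \<exists>y\<in>e. {x, y} \<in> E)" using disj by blast
next
  let ?S = "{xs. graph_path E xs \<and> hd xs \<in> d \<and> last xs \<in> e}"
  assume *: "d \<inter> e = {} \<and> (\<exists>x\<in>d. \<exists>y\<in>e. {x, y} \<in> E)"
  then obtain x y where xy: "x \<in> d" "y \<in> e" "{x, y} \<in> E" by blast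
  then have "[x, y] \<in> ?S" using * by (auto simp: graph_path_def)
  then have "graph_distance E d e \<le> enat (length [x, y] - 1)"
    unfolding graph_distance_def by (rule INF_lower)
  moreover have "1 \<le> graph_distance E d e"
    unfolding graph_distance_def
  proof (rule INF_greatest)
    fix xs assume xs: "xs \<in> ?S"
    have "length xs \<noteq> 0" "length xs \<noteq> 1"
      using xs * by (auto simp: graph_path_def length_Suc_conv)
    then have "1 \<le> length xs - 1" by linarith
    then show "1 \<le> enat (length xs - 1)" by (simp only: one_enat_def enat_ord_simps)
  qed
  ultimately show "graph_distance E d e = 1" by (simp add: one_enat_def antisym)
qed

lemma edge_codes_less: "p \<in> set edge_codes \<Longrightarrow> fst p < snd p \<and> snd p < 10"
  by (auto simp: edge_codes_def)

lemma vertex_eq_iff: "i < 10 \<Longrightarrow> j < 10 \<Longrightarrow> vertex i = vertex j \<longleftrightarrow> i = j"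
  using bij_vertex by (auto simp: bij_betw_def inj_on_def)

lemma edge_eq_iff:
  assumes "p \<in> set edge_codes" "fst q < snd q" "snd q < 10"
  shows "edge p = edge q \<longleftrightarrow> p = q"
  using edge_codes_less[OF assms(1)] assms(2,3)
  by (auto simp: edge_def doubleton_eq_iff vertex_eq_iff prod_eq_iff)

lemma edge_in_petersen_edges_iff:
  assumes "u < 10" "v < 10"
  shows "{vertex u, vertex v} \<in> petersen_edges \<longleftrightarrow> (u, v) \<in> set edge_codes \<or> (v, u) \<in> set edge_codes"
proof
  assume "{vertex u, vertex v} \<in> petersen_edges"
  then obtain p where p: "p \<in> set edge_codes" "{vertex u, vertex v} = edge p"
    by (auto simp: petersen_edges_eq)
  then have "p = (u, v) \<or> p = (v, u)"
    using edge_codes_less[OF p(1)] assms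
    by (auto simp: edge_def doubleton_eq_iff vertex_eq_iff prod_eq_iff)
  then show "(u, v) \<in> set edge_codes \<or> (v, u) \<in> set edge_codes" using p by auto
next
  assume "(u, v) \<in> set edge_codes \<or> (v, u) \<in> set edge_codes"
  then show "{vertex u, vertex v} \<in> petersen_edges"
    by (force simp: petersen_edges_eq edge_def insert_commute)
qed

lemma edge_disjoint_iff:
  assumes "p \<in> set edge_codes" "q \<in> set edge_codes"
  shows "edge p \<inter> edge q = {} \<longleftrightarrow> {fst p, snd p} \<inter> {fst q, snd q} = {}"
  using edge_codes_less[OF assms(1)] edge_codes_less[OF assms(2)]
  by (auto simp: edge_def vertex_eq_iff)

lemma graph_distance_edge_eq_1_iff:
  assumes "p \<in> set edge_codes" "q \<in> set edge_codes"
  shows "graph_distance petersen_edges (edge p) (edge q) = 1 \<longleftrightarrow> at_distance_1 p q"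
proof -
  have *: "{vertex u, vertex v} \<in> petersen_edges \<longleftrightarrow> (u, v) \<in> set edge_codes \<or> (v, u) \<in> set edge_codes"
    if "u \<in> {fst p, snd p}" "v \<in> {fst q, snd q}" for u v
    using that edge_codes_less[OF assms(1)] edge_codes_less[OF assms(2)]
    by (intro edge_in_petersen_edges_iff) auto
  have "(\<exists>x\<in>edge p. \<exists>y\<in>edge q. {x, y} \<in> petersen_edges) \<longleftrightarrow>
      (\<exists>u\<in>{fst p, snd p}. \<exists>v\<in>{fst q, snd q}. {vertex u, vertex v} \<in> petersen_edges)"
    by (auto simp: edge_def)
  also have "\<dots> \<longleftrightarrow> (\<exists>u\<in>{fst p, snd p}. \<exists>v\<in>{fst q, snd q}. (u, v) \<in> set edge_codes \<or> (v, u) \<in> set edge_codes)"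
    by (intro bex_cong refl *)
  finally show ?thesis
    unfolding graph_distance_eq_1_iff at_distance_1_def edge_disjoint_iff[OF assms] by simp
qed

section \<open>Sums over the pairs of edges at distance 1\<close>

lemma at_distance_1_sym: "at_distance_1 p q \<longleftrightarrow> at_distance_1 q p"
  unfolding at_distance_1_def by blast

definition pair_codes :: "((nat \<times> nat) \<times> (nat \<times> nat)) set" where
  "pair_codes = {(p, q) \<in> set edge_codes \<times> set edge_codes. before p q \<and> at_distance_1 p q}"

lemma edge_pairs_at_distance_1_eq:
  "edge_pairs_at_distance_1 petersen_edges = (\<lambda>(p, q). {edge p, edge q}) ` pair_codes"
proof (intro equalityI subsetI)
  fix P assume "P \<in> edge_pairs_at_distance_1 petersen_edges"
  then obtain d e where de: "d \<in> petersen_edges" "e \<in> petersen_edges" "P = {d, e}"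
      "graph_distance petersen_edges d e = 1"
    unfolding edge_pairs_at_distance_1_def by blast
  moreover from de(1,2) obtain p q where "p \<in> set edge_codes" "q \<in> set edge_codes" "d = edge p" "e = edge q"
    unfolding petersen_edges_eq by blast
  ultimately have pq: "p \<in> set edge_codes" "q \<in> set edge_codes" "P = {edge p, edge q}" "at_distance_1 p q"
    by (simp_all add: graph_distance_edge_eq_1_iff)
  then have "p \<noteq> q" by (auto simp: at_distance_1_def)
  then have "before p q \<or> before q p" by (auto simp: before_def prod_eq_iff)
  then have "(p, q) \<in> pair_codes \<or> (q, p) \<in> pair_codes"
    using pq at_distance_1_sym by (auto simp: pair_codes_def)
  moreover have "P = {edge q, edge p}" using pq(3) by blast
  ultimately show "P \<in> (\<lambda>(p, q). {edge p, edge q}) ` pair_codes"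
    using pq(3) by (auto intro: rev_image_eqI)
next
  fix P assume "P \<in> (\<lambda>(p, q). {edge p, edge q}) ` pair_codes"
  then obtain p q where pq: "p \<in> set edge_codes" "q \<in> set edge_codes" "P = {edge p, edge q}" "at_distance_1 p q"
    by (auto simp: pair_codes_def)
  then have "edge p \<in> petersen_edges" "edge q \<in> petersen_edges" "P = {edge p, edge q}"
    by (simp_all add: petersen_edges_eq)
  moreover have "graph_distance petersen_edges (edge p) (edge q) = 1"
    using pq by (simp add: graph_distance_edge_eq_1_iff)
  ultimately show "P \<in> edge_pairs_at_distance_1 petersen_edges"
    unfolding edge_pairs_at_distance_1_def by blast
qed

text \<open>Equal unordered pairs could also match crosswise, but \<open>before\<close> cannot hold
  in both directions.\<close>

lemma inj_on_pair_codes: "inj_on (\<lambda>(p, q). {edge p, edge q}) pair_codes"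
proof (rule inj_onI, clarify)
  fix p q p' q'
  assume "(p, q) \<in> pair_codes" "(p', q') \<in> pair_codes" and eq: "{edge p, edge q} = {edge p', edge q'}"
  then have "p \<in> set edge_codes" "q \<in> set edge_codes" "p' \<in> set edge_codes" "q' \<in> set edge_codes"
      "before p q" "before p' q'"
    by (auto simp: pair_codes_def)
  moreover from this have "p = p' \<and> q = q' \<or> p = q' \<and> q = p'"
    using eq edge_eq_iff edge_codes_less by (auto simp: doubleton_eq_iff)
  ultimately show "p = p' \<and> q = q'" by (auto simp: before_def)
qed

text \<open>With the restriction turned into a weight, the index set is a product and the two
  summations can be exchanged.\<close>

lemma sum_pair_codes:
  fixes h :: "nat \<times> nat \<Rightarrow> nat \<times> nat \<Rightarrow> int"
  shows "(\<Sum>(p, q)\<in>pair_codes. h p q)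
    = (\<Sum>q\<in>set edge_codes. \<Sum>p\<in>set edge_codes. of_bool (before p q \<and> at_distance_1 p q) * h p q)"
proof -
  have "(\<Sum>(p, q)\<in>pair_codes. h p q)
      = (\<Sum>z\<in>set edge_codes \<times> set edge_codes.
           case z of (p, q) \<Rightarrow> of_bool (before p q \<and> at_distance_1 p q) * h p q)"
    unfolding pair_codes_def by (intro sum.mono_neutral_cong_left) auto
  also have "\<dots> = (\<Sum>p\<in>set edge_codes. \<Sum>q\<in>set edge_codes. of_bool (before p q \<and> at_distance_1 p q) * h p q)"
    by (simp only: sum.cartesian_product)
  finally show ?thesis by (subst (asm) sum.swap)
qed

lemma distinct_edge_codes: "distinct edge_codes"
  by (simp add: edge_codes_def)

text \<open>Exchanging the names of \<open>p\<close> and \<open>q\<close> in the second half of the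
  summand turns the sum over unordered pairs into one over all ordered pairs at distance 1. For a
  fixed \<open>q\<close> the inner sum is then even.\<close>

lemma even_sum_pair_codes:
  fixes n :: "nat \<Rightarrow> nat \<times> nat \<Rightarrow> int"
  shows "even (\<Sum>(p, q)\<in>pair_codes. (n (fst p) q + n (snd p) q) + (n (fst q) p + n (snd q) p))"
proof -
  let ?E = "set edge_codes"
  define N where "N p q = n (fst p) q + n (snd p) q" for p q
  \<comment> \<open>No edge has distance 1 from itself, so exactly one order of each such pair
    satisfies \<open>before\<close>.\<close>
  have tot: "of_bool (before p q \<and> at_distance_1 p q) + of_bool (before q p \<and> at_distance_1 q p)
      = (of_bool (at_distance_1 p q) :: int)" for p q
  proof (cases "at_distance_1 p q")
    case True
    then have "p \<noteq> q" by (auto simp: at_distance_1_def)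
    then show ?thesis using True at_distance_1_sym[of p q] by (auto simp: before_def prod_eq_iff)
  qed (auto simp: at_distance_1_sym[of q p])
  have "(\<Sum>(p, q)\<in>pair_codes. N p q + N q p)
      = (\<Sum>q\<in>?E. \<Sum>p\<in>?E. of_bool (before p q \<and> at_distance_1 p q) * N p q)
        + (\<Sum>q\<in>?E. \<Sum>p\<in>?E. of_bool (before p q \<and> at_distance_1 p q) * N q p)"
    unfolding sum_pair_codes by (simp add: distrib_left sum.distrib)
  also have "(\<Sum>q\<in>?E. \<Sum>p\<in>?E. of_bool (before p q \<and> at_distance_1 p q) * N q p)
      = (\<Sum>q\<in>?E. \<Sum>p\<in>?E. of_bool (before q p \<and> at_distance_1 q p) * N p q)"
    by (rule sum.swap)
  also have "(\<Sum>q\<in>?E. \<Sum>p\<in>?E. of_bool (before p q \<and> at_distance_1 p q) * N p q) + \<dots>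
      = (\<Sum>q\<in>?E. \<Sum>p\<in>?E. of_bool (at_distance_1 p q) * N p q)"
    by (simp only: sum.distrib[symmetric] distrib_right[symmetric] tot)
  also have "\<dots> = (\<Sum>q\<in>?E. \<Sum>p\<leftarrow>filter (\<lambda>p. at_distance_1 p q) edge_codes. N p q)"
  proof (rule sum.cong[OF refl])
    fix q
    have "(\<Sum>p\<leftarrow>filter (\<lambda>p. at_distance_1 p q) edge_codes. N p q)
        = (\<Sum>p\<in>{p \<in> ?E. at_distance_1 p q}. N p q)"
      by (subst sum_list_distinct_conv_sum_set) (simp_all add: distinct_edge_codes)
    also have "\<dots> = (\<Sum>p\<in>?E. of_bool (at_distance_1 p q) * N p q)"
      by (intro sum.mono_neutral_cong_left) auto
    finally show "(\<Sum>p\<in>?E. of_bool (at_distance_1 p q) * N p q)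
        = (\<Sum>p\<leftarrow>filter (\<lambda>p. at_distance_1 p q) edge_codes. N p q)" by simp
  qed
  also have "even \<dots>"
    by (intro dvd_sum) (simp add: N_def sum_at_distance_1_even[of _ "\<lambda>v. n v q" for q])
  finally show ?thesis by (simp add: N_def)
qed

lemma odd_sum_interlaced: "odd (\<Sum>(p, q)\<in>pair_codes. of_bool (interlaced p q) :: int)"
proof -
  have "(\<Sum>(p, q)\<in>pair_codes. of_bool (interlaced p q) :: int)
      = (\<Sum>q\<in>set edge_codes. \<Sum>p\<in>set edge_codes. of_bool (interlaced p q \<and> before p q \<and> at_distance_1 p q))"
    unfolding sum_pair_codes by (intro sum.cong refl) auto
  also have "\<dots> = 21"
    using count_interlaced by (simp add: sum_list_distinct_conv_sum_set distinct_edge_codes)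
  finally show ?thesis by simp
qed

theorem theorem1p3:
  fixes f :: "real^petersen_vertex \<Rightarrow> real^2"
  assumes "plane_generic_immersion petersen_edges f"
  shows "[(\<Sum>P\<in>edge_pairs_at_distance_1 petersen_edges. card (\<Inter>d\<in>P. f ` edge_arc d)) = 1] (mod 2)"
proof -
  interpret generic_immersion petersen_edges f
  proof
    fix a b assume "{a, b} \<in> petersen_edges"
    then show "a \<noteq> b"
      using edge_codes_less by (force simp: petersen_edges_eq edge_def doubleton_eq_iff vertex_eq_iff)
  qed fact
  define ord where "ord = inv_into {..<10} vertex"
  have ord: "ord (vertex i) = i" if "i < 10" for i
    using bij_vertex that by (simp add: ord_def bij_betw_def)
  have "inj ord"
    using bij_betw_inv_into[OF bij_vertex] by (simp add: ord_def bij_betw_def)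
  then obtain n :: "petersen_vertex \<Rightarrow> petersen_vertex \<times> petersen_vertex \<Rightarrow> int" where
    n: "\<And>a b x y. {a, b} \<in> petersen_edges \<Longrightarrow> {x, y} \<in> petersen_edges \<Longrightarrow> {a, b} \<inter> {x, y} = {} \<Longrightarrow>
       ord a < ord b \<Longrightarrow> ord x < ord y \<Longrightarrow>
       even (int (card (f ` edge_arc {a, b} \<inter> f ` edge_arc {x, y}))
             + of_bool (ord a < ord x \<and> ord x < ord b \<and> ord b < ord y \<or>
                        ord x < ord a \<and> ord a < ord y \<and> ord y < ord b)
             + n a (x, y) + n b (x, y) + n x (a, b) + n y (a, b))"
    using crossing_parity_formula by blast
  define m where "m v p = n (vertex v) (vertex (fst p), vertex (snd p))" for v p
  define c where "c p q = int (card (f ` edge_arc (edge p) \<inter> f ` edge_arc (edge q)))" for p q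
  have pair: "even (c p q + of_bool (interlaced p q)
      + ((m (fst p) q + m (snd p) q) + (m (fst q) p + m (snd q) p)))" if "(p, q) \<in> pair_codes" for p q
  proof -
    have pq: "p \<in> set edge_codes" "q \<in> set edge_codes" "at_distance_1 p q"
      using that by (auto simp: pair_codes_def)
    then have "edge p \<in> petersen_edges" "edge q \<in> petersen_edges" "edge p \<inter> edge q = {}"
      using edge_disjoint_iff by (auto simp: petersen_edges_eq at_distance_1_def)
    moreover have "fst p < snd p" "fst p < 10" "snd p < 10" "fst q < snd q" "fst q < 10" "snd q < 10"
      using edge_codes_less pq by fastforce+
    ultimately show ?thesis
      using n[of "vertex (fst p)" "vertex (snd p)" "vertex (fst q)" "vertex (snd q)"]
      unfolding edge_def[symmetric] c_def m_def interlaced_def by (simp add: ord algebra_simps)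
  qed
  have "even (\<Sum>(p, q)\<in>pair_codes. c p q + of_bool (interlaced p q)
      + ((m (fst p) q + m (snd p) q) + (m (fst q) p + m (snd q) p)))"
    using pair by (intro dvd_sum) auto
  also have "(\<Sum>(p, q)\<in>pair_codes. c p q + of_bool (interlaced p q)
      + ((m (fst p) q + m (snd p) q) + (m (fst q) p + m (snd q) p)))
    = (\<Sum>(p, q)\<in>pair_codes. c p q) + (\<Sum>(p, q)\<in>pair_codes. of_bool (interlaced p q))
      + (\<Sum>(p, q)\<in>pair_codes. (m (fst p) q + m (snd p) q) + (m (fst q) p + m (snd q) p))"
    unfolding case_prod_unfold by (simp only: sum.distrib)
  finally have "odd (\<Sum>(p, q)\<in>pair_codes. c p q)"
    using odd_sum_interlaced even_sum_pair_codes[of m] by simp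
  \<comment> \<open>Injectivity on \<open>pair_codes\<close> ensures that each unordered pair is
    counted once.\<close>
  also have "(\<Sum>(p, q)\<in>pair_codes. c p q)
      = int (\<Sum>P\<in>edge_pairs_at_distance_1 petersen_edges. card (\<Inter>d\<in>P. f ` edge_arc d))"
    unfolding edge_pairs_at_distance_1_eq
    by (subst sum.reindex[OF inj_on_pair_codes]) (simp add: c_def case_prod_unfold)
  finally have "odd (\<Sum>P\<in>edge_pairs_at_distance_1 petersen_edges. card (\<Inter>d\<in>P. f ` edge_arc d))"
    by (simp only: even_of_nat_iff not_False_eq_True)
  then show ?thesis
    by (simp add: cong_def odd_iff_mod_2_eq_one)
qed

end
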